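(* Let $A$ be a local principal ideal commutative ring of length $\ell\in\mathbb{N}\cup\{\infty\}$ with maximal ideal $\mathfrak{m}$ and finite residue field $A/\mathfrak{m}$ of cardinality $q$. For every integer $\imath$ with $1\le\imath\le\ell$, put $A_\imath=A/\mathfrak{m}^\imath$. Then the number of similarity classes of matrices in $M_3(A_\imath)$ is $$\frac{q^{3\imath+3}+q^{3\imath-1}-q^{2\imath+2}-q^{2\imath+1}-q^{2\imath}-q^{2\imath-1}+2q^\imath}{(q-1)(q^2-1)},$$ and the number of similarity classes of elements in $\mathrm{GL}_3(A_\imath)$ is $$\frac{q^{3\imath+2}-q^{3\imath}+2q^{3\imath-2}-q^{2\imath+1}-q^{2\imath-1}-2q^{2\imath-2}+2q^{\imath-1}}{q^2-1}.$$
   Context: The length $\ell$ of $A$ is the smallest positive integer with $\mathfrak{m}^\ell=0$, and $\ell=\infty$ if there is none. Two matrices $\alpha,\alpha'\in M_3(R)$ over a commutative ring $R$ are similar if $X\alpha=\alpha'X$ for some $X\in\mathrm{GL}_3(R)$; similarity classes in $\mathrm{GL}_3(R)$ are its conjugacy classes. *)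

theory Defs
  imports
    "HOL-Algebra.Ideal_Product"
    "HOL-Algebra.QuotRing"
    "HOL-Analysis.Finite_Cartesian_Product"
    "HOL-Library.Extended_Nat"
begin

locale local_ring = cring +
  assumes ex1_maximalideal: "\<exists>!M. maximalideal M R"

locale principal_ideal_ring = cring +
  assumes all_principalideal: "\<And>I. ideal I R \<Longrightarrow> principalideal I R"

text \<open>Powers are taken in the multiplicative monoid of ideals; the zeroth power is the
  whole ring.\<close>

abbreviation ideal_power :: "('a, 'b) ring_scheme \<Rightarrow> 'a set \<Rightarrow> nat \<Rightarrow> 'a set" where
  "ideal_power R I n \<equiv> I [^]\<^bsub>ideals_set R\<^esub> n"

definition nilpotency_length :: "('a, 'b) ring_scheme \<Rightarrow> 'a set \<Rightarrow> enat" where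
  "nilpotency_length R I =
     (if \<exists>n\<ge>1. ideal_power R I n = {\<zero>\<^bsub>R\<^esub>}
      then enat (LEAST n. 1 \<le> n \<and> ideal_power R I n = {\<zero>\<^bsub>R\<^esub>})
      else \<infinity>)"

text \<open>Square matrices over a ring given by a carrier set: only the indices are encoded by a
  type, and the arithmetic is that of the record \<open>R\<close>, not of a type class on \<open>'a\<close>. Hence
  \<open>Units (mat_monoid R)\<close> is the general linear group over \<open>R\<close>.\<close>

definition mat_monoid :: "('a, 'b) ring_scheme \<Rightarrow> ('a ^ 'n ^ 'n) monoid" where
  "mat_monoid R =
     \<lparr>carrier = {M. \<forall>i j. M $ i $ j \<in> carrier R},
      monoid.mult = (\<lambda>M N. \<chi> i j. \<Oplus>\<^bsub>R\<^esub>k\<in>UNIV. M $ i $ k \<otimes>\<^bsub>R\<^esub> N $ k $ j),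
      one = (\<chi> i j. if i = j then \<one>\<^bsub>R\<^esub> else \<zero>\<^bsub>R\<^esub>)\<rparr>"

definition similarity :: "('a, 'b) ring_scheme \<Rightarrow> (('a ^ 'n ^ 'n) \<times> ('a ^ 'n ^ 'n)) set" where
  "similarity R =
     {(M, N). M \<in> carrier (mat_monoid R) \<and> N \<in> carrier (mat_monoid R) \<and>
       (\<exists>X\<in>Units (mat_monoid R).
          X \<otimes>\<^bsub>mat_monoid R\<^esub> M = N \<otimes>\<^bsub>mat_monoid R\<^esub> X)}"

definition similarity_classes :: "('a, 'b) ring_scheme \<Rightarrow> ('a ^ 'n ^ 'n) set set" where
  "similarity_classes R = carrier (mat_monoid R) // similarity R"

definition GL_similarity_classes :: "('a, 'b) ring_scheme \<Rightarrow> ('a ^ 'n ^ 'n) set set" where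
  "GL_similarity_classes R = Units (mat_monoid R) // similarity R"

end

theory Submission
  imports Defs "HOL-Analysis.Determinants" "HOL-Algebra.Ring_Divisibility"
begin

text \<open>Let \<open>p\<close> generate the maximal ideal. A matrix over \<open>A/(p\<^sup>k)\<close> that is scalar modulo \<open>p\<close> is
  \<open>d + p B\<close>, where the residue \<open>d\<close> and the class of \<open>B\<close> modulo \<open>p\<^sup>k\<^sup>-\<^sup>1\<close> are determined by its
  class; this gives a recursion over \<open>k\<close>. If a matrix is not scalar modulo \<open>p\<close>, some vector
  \<open>e\<close> and its image are part of a basis, which can be completed by a vector \<open>f\<close> such that,
  after subtracting a scalar \<open>x\<close>, the matrix acts by some \<open>\<tau>\<close> with \<open>\<tau> f = z e\<close> and
  \<open>\<tau>\<^sup>2 e = u \<tau> e + v e + w f\<close>. The largest \<open>m\<close> for which \<open>p\<^sup>m\<close> divides \<open>v\<close>, \<open>z\<close> and \<open>w\<close> is an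
  invariant, and so is \<open>x\<close> modulo \<open>p\<^sup>m\<close>. Changing \<open>e\<close> and \<open>f\<close> one reaches \<open>z = p\<^sup>m\<close>, with \<open>x\<close> a fixed
  representative modulo \<open>p\<^sup>m\<close>, unless \<open>v\<close> and \<open>z\<close> are divisible by \<open>p\<^sup>m\<^sup>+\<^sup>1\<close>, \<open>u\<close> is divisible
  by \<open>p\<close> and \<open>0 < m < k\<close>; then one reaches \<open>w = p\<^sup>m\<close> instead. The trace, the determinants of
  shifts and the entries of an intertwiner show that the remaining parameters are unique.\<close>

section \<open>Principal local rings modulo an ideal\<close>

text \<open>All computations take place in a ring \<open>'a\<close> of type class \<open>comm_ring_1\<close> of which the given
  local ring is the quotient by \<open>K\<close>; \<open>I j\<close> is then the preimage of the \<open>j\<close>-th power of the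
  maximal ideal, \<open>L\<close> is a lower bound of the length, and \<open>T\<close> represents the residue field.\<close>

locale truncated_principal_local =
  fixes K :: "'a::comm_ring_1 set" and p :: 'a and L :: nat and T :: "'a set"
  assumes K_zero: "0 \<in> K"
    and K_add: "x \<in> K \<Longrightarrow> y \<in> K \<Longrightarrow> x + y \<in> K"
    and K_mult: "x \<in> K \<Longrightarrow> c * x \<in> K"
    and unit_mod_K: "(\<And>y. x - p * y \<notin> K) \<Longrightarrow> \<exists>y. x * y - 1 \<in> K"
    and power_not_in: "j < L \<Longrightarrow> p ^ j - p ^ Suc j * y \<notin> K"
    and L_pos: "0 < L"
    and finite_T: "finite T"
    and ex_T: "\<exists>s\<in>T. \<exists>y. x - s - p * y \<in> K"
    and unique_T: "s \<in> T \<Longrightarrow> t \<in> T \<Longrightarrow> s - t - p * y \<in> K \<Longrightarrow> s = t"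
begin

definition I :: "nat \<Rightarrow> 'a set" where
  "I j = {x. \<exists>y. x - p ^ j * y \<in> K}"

abbreviation q :: nat where "q \<equiv> card T"

lemma K_uminus: "x \<in> K \<Longrightarrow> - x \<in> K"
  using K_mult[of x "-1"] by simp

lemma K_diff: "x \<in> K \<Longrightarrow> y \<in> K \<Longrightarrow> x - y \<in> K"
  using K_add[of x "- y"] K_uminus by simp

lemma K_subset_I: "x \<in> K \<Longrightarrow> x \<in> I j"
  unfolding I_def by (auto intro!: exI[of _ 0])

lemma I_zero [simp]: "0 \<in> I j"
  using K_subset_I K_zero by blast

lemma I_add: "x \<in> I j \<Longrightarrow> y \<in> I j \<Longrightarrow> x + y \<in> I j"
proof -
  assume "x \<in> I j" "y \<in> I j"
  then obtain a b where "x - p ^ j * a \<in> K" "y - p ^ j * b \<in> K"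
    unfolding I_def by blast
  then have "(x - p ^ j * a) + (y - p ^ j * b) \<in> K" by (rule K_add)
  then have "x + y - p ^ j * (a + b) \<in> K" by (simp add: algebra_simps)
  then show ?thesis unfolding I_def by blast
qed

lemma I_mult: "x \<in> I j \<Longrightarrow> c * x \<in> I j"
proof -
  assume "x \<in> I j"
  then obtain a where "x - p ^ j * a \<in> K" unfolding I_def by blast
  then have "c * (x - p ^ j * a) \<in> K" by (rule K_mult)
  then have "c * x - p ^ j * (c * a) \<in> K" by (simp add: algebra_simps)
  then show ?thesis unfolding I_def by blast
qed

lemma I_mult_right: "x \<in> I j \<Longrightarrow> x * c \<in> I j"
  using I_mult[of x j c] by (simp add: mult.commute)

lemma I_uminus: "x \<in> I j \<Longrightarrow> - x \<in> I j"
  using I_mult[of x j "-1"] by simp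

lemma I_diff: "x \<in> I j \<Longrightarrow> y \<in> I j \<Longrightarrow> x - y \<in> I j"
  using I_add[of x j "- y"] I_uminus by simp

lemma I_uminus_iff [simp]: "- x \<in> I j \<longleftrightarrow> x \<in> I j"
  using I_uminus[of x] I_uminus[of "- x"] by auto

lemma I_comb1: "a \<in> I k \<Longrightarrow> x = c * a \<Longrightarrow> x \<in> I k"
  by (simp add: I_mult)

lemma I_comb2: "a \<in> I k \<Longrightarrow> b \<in> I k \<Longrightarrow> x = c * a + d * b \<Longrightarrow> x \<in> I k"
  by (simp add: I_mult I_add)

lemma I_comb3:
  "a \<in> I k \<Longrightarrow> b \<in> I k \<Longrightarrow> b' \<in> I k \<Longrightarrow> x = c * a + d * b + d' * b' \<Longrightarrow> x \<in> I k"
  by (simp add: I_mult I_add)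

lemma I_0 [simp]: "x \<in> I 0"
  unfolding I_def using K_zero by (auto intro!: exI[of _ x])

lemma power_mult_in: "p ^ j * y \<in> I j"
  unfolding I_def using K_zero by (auto intro!: exI[of _ y])

lemma p_mult_in [simp]: "p * y \<in> I (Suc 0)"
  using power_mult_in[of 1 y] by simp

lemma I_antimono: "x \<in> I j \<Longrightarrow> i \<le> j \<Longrightarrow> x \<in> I i"
proof -
  assume "x \<in> I j" "i \<le> j"
  then obtain y where "x - p ^ j * y \<in> K" unfolding I_def by blast
  moreover have "p ^ j = p ^ i * p ^ (j - i)" using \<open>i \<le> j\<close> by (simp flip: power_add)
  ultimately have "x - p ^ i * (p ^ (j - i) * y) \<in> K" by (simp add: mult.assoc)
  then show ?thesis unfolding I_def by blast
qed

text \<open>The remainder lies in \<open>K\<close>, hence in every \<open>I k\<close>. One quotient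
  \<open>y\<close> therefore serves all precisions at once, and later proofs may choose
  \<open>k\<close> afterwards.\<close>

lemma I_obtain:
  assumes "x \<in> I j" obtains y where "\<And>k. x - p ^ j * y \<in> I k"
  using assms K_subset_I unfolding I_def by blast

lemma one_not_in [simp]: "1 \<notin> I (Suc 0)"
  using power_not_in[of 0] L_pos by (auto simp: I_def)

lemma I_unit:
  assumes "x \<notin> I 1" obtains y where "\<And>k. x * y - 1 \<in> I k"
proof -
  obtain y where "x * y - 1 \<in> K" using assms unit_mod_K[of x] by (auto simp: I_def)
  then show ?thesis using that K_subset_I by blast
qed

lemma unit_cancel:
  assumes "c \<notin> I 1" "c * x \<in> I k" shows "x \<in> I k"
proof -
  obtain d where "c * d - 1 \<in> I k" using I_unit[OF assms(1)] by blast
  from I_comb2[OF assms(2) this, of x d "- x"] show ?thesis by (simp add: algebra_simps)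
qed

lemma I_prime: "x * y \<in> I 1 \<Longrightarrow> x \<in> I 1 \<or> y \<in> I 1"
  using unit_cancel by blast

lemma I_prime_iff: "x * y \<in> I 1 \<longleftrightarrow> x \<in> I 1 \<or> y \<in> I 1"
  using I_prime I_mult I_mult_right by blast

lemma I_shift: "x - y \<in> I k \<Longrightarrow> x \<in> I k \<longleftrightarrow> y \<in> I k"
  using I_add[of "x - y" k y] I_diff[of x k "x - y"] by auto

text \<open>Membership in \<open>I i\<close> is raised step by step up to \<open>i = j\<close>. If
  the step from \<open>i\<close> failed, \<open>x\<close> would be \<open>p ^ i\<close> times a unit
  modulo \<open>K\<close>; multiplying by the inverse of that unit puts \<open>p ^ Suc i\<close>
  into \<open>I (Suc (Suc i))\<close>, which \<open>power_not_in\<close> forbids below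
  \<open>L\<close>.\<close>

lemma I_Suc_cancel:
  assumes "p * x \<in> I (Suc j)" "Suc j \<le> L" shows "x \<in> I j"
proof -
  obtain w where w: "p * x - p ^ Suc j * w \<in> K" using assms(1) unfolding I_def by blast
  have "i \<le> j \<Longrightarrow> x \<in> I i" for i
  proof (induction i)
    case (Suc i)
    then obtain y where y: "x - p ^ i * y \<in> K" unfolding I_def by auto
    show ?case
    proof (cases "y \<in> I 1")
      case True
      then obtain v where "y - p * v \<in> K" unfolding I_def by auto
      then have "(x - p ^ i * y) + p ^ i * (y - p * v) \<in> K" using y K_add K_mult by blast
      then have "x - p ^ Suc i * v \<in> K" by (simp add: algebra_simps)
      then show ?thesis unfolding I_def by blast
    next
      case False
      then obtain y' where y': "y * y' - 1 \<in> K" using unit_mod_K[of y] by (auto simp: I_def)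
      have j: "p ^ j = p ^ Suc i * p ^ (j - Suc i)" using Suc.prems by (simp flip: power_add power_Suc)
      have "y' * (p * x - p ^ Suc j * w) - (p * y') * (x - p ^ i * y) - p ^ Suc i * (y * y' - 1) \<in> K"
        by (intro K_diff K_mult[OF w] K_mult[OF y] K_mult[OF y'])
      also have "y' * (p * x - p ^ Suc j * w) - (p * y') * (x - p ^ i * y) - p ^ Suc i * (y * y' - 1)
         = p ^ Suc i - p * p ^ j * w * y'" by (simp add: algebra_simps)
      also have "\<dots> = p ^ Suc i - p ^ Suc (Suc i) * (p ^ (j - Suc i) * w * y')"
        unfolding j by (simp add: algebra_simps)
      finally show ?thesis using power_not_in[of "Suc i"] Suc.prems assms(2) by auto
    qed
  qed simp
  then show ?thesis by simp
qed

lemma I_cancel: "p ^ i * x \<in> I (i + j) \<Longrightarrow> i + j \<le> L \<Longrightarrow> x \<in> I j"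
  by (induction i) (auto simp: mult.assoc intro: I_Suc_cancel)

lemma I_power_mult: "x \<in> I j \<Longrightarrow> p ^ i * x \<in> I (i + j)"
proof -
  assume "x \<in> I j"
  then obtain y where "x - p ^ j * y \<in> K" unfolding I_def by blast
  then have "p ^ i * (x - p ^ j * y) \<in> K" by (rule K_mult)
  then have "p ^ i * x - p ^ (i + j) * y \<in> K" by (simp add: algebra_simps power_add)
  then show ?thesis unfolding I_def by blast
qed

lemma I_power_mult_iff: "i + j \<le> L \<Longrightarrow> p ^ i * x \<in> I (i + j) \<longleftrightarrow> x \<in> I j"
  using I_cancel I_power_mult by blast

lemma I_power_cancel: "p ^ i * x \<in> I k \<Longrightarrow> i \<le> k \<Longrightarrow> k \<le> L \<Longrightarrow> x \<in> I (k - i)"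
  using I_cancel[of i x "k - i"] by simp

lemma power_in_I_iff: "i \<le> L \<Longrightarrow> j \<le> L \<Longrightarrow> p ^ i \<in> I j \<longleftrightarrow> j \<le> i"
proof
  assume "i \<le> L" "j \<le> L" "p ^ i \<in> I j"
  show "j \<le> i"
  proof (rule ccontr)
    assume "\<not> j \<le> i"
    then have "p ^ i * 1 \<in> I (i + 1)" using I_antimono[OF \<open>p ^ i \<in> I j\<close>, of "i + 1"] by simp
    then have "1 \<in> I 1" using \<open>j \<le> L\<close> \<open>\<not> j \<le> i\<close> by (intro I_cancel[OF \<open>p ^ i * 1 \<in> I (i + 1)\<close>]) simp
    then show False by simp
  qed
next
  assume "j \<le> i" then show "p ^ i \<in> I j" using I_antimono power_mult_in[of i 1] by auto
qed

section \<open>Representatives modulo \<open>I j\<close>: expansions in powers of \<open>p\<close>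
  with \<open>j\<close> digits from \<open>T\<close>\<close>

primrec S :: "nat \<Rightarrow> 'a set" where
  "S 0 = {0}"
| "S (Suc j) = (\<lambda>(s, y). s + p * y) ` (T \<times> S j)"

lemma T_eq: "s \<in> T \<Longrightarrow> t \<in> T \<Longrightarrow> s - t \<in> I 1 \<Longrightarrow> s = t"
  using unique_T unfolding I_def by auto

lemma T_ex: "\<exists>s\<in>T. x - s \<in> I 1"
  using ex_T[of x] unfolding I_def by simp

lemma S_ex: "\<exists>s\<in>S j. x - s \<in> I j"
proof (induction j arbitrary: x)
  case (Suc j)
  obtain s where s: "s \<in> T" "x - s \<in> I 1" using T_ex by blast
  then obtain y where y: "\<And>k. x - s - p * y \<in> I k" using I_obtain[of "x - s" 1] by auto
  obtain t where t: "t \<in> S j" "y - t \<in> I j" using Suc by blast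
  have "(x - s - p * y) + p ^ 1 * (y - t) \<in> I (Suc j)"
    using y I_power_mult[OF t(2), of 1] by (intro I_add) simp_all
  then have "x - (s + p * t) \<in> I (Suc j)" by (simp add: algebra_simps)
  then show ?case using s t by force
qed simp

text \<open>Reduction modulo \<open>I 1\<close> isolates the leading digit; after it is removed, the
  factor \<open>p\<close> can be cancelled at the cost of one level.\<close>

lemma decomposition_inj:
  assumes "s \<in> T" "t \<in> T" "(s + p * x) - (t + p * y) \<in> I (Suc j)" "Suc j \<le> L"
  shows "s = t" "x - y \<in> I j"
proof -
  have "(s + p * x) - (t + p * y) \<in> I 1" by (rule I_antimono[OF assms(3)]) simp
  then have "(s + p * x) - (t + p * y) - p * (x - y) \<in> I 1" by (rule I_diff) simp
  then have "s - t \<in> I 1" by (simp add: algebra_simps)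
  then show st: "s = t" using T_eq assms by blast
  have "p * (x - y) \<in> I (Suc j)" using assms(3) st by (simp add: algebra_simps)
  then show "x - y \<in> I j" using assms(4) by (rule I_Suc_cancel)
qed

lemma S_eq: "s \<in> S j \<Longrightarrow> t \<in> S j \<Longrightarrow> s - t \<in> I j \<Longrightarrow> j \<le> L \<Longrightarrow> s = t"
proof (induction j arbitrary: s t)
  case (Suc j)
  then obtain a b x y where "a \<in> T" "b \<in> T" "x \<in> S j" "y \<in> S j" "s = a + p * x" "t = b + p * y"
    by auto
  then show ?case using Suc decomposition_inj[of a b x y j] by auto
qed simp

lemma finite_S [simp]: "finite (S j)"
  by (induction j) (auto simp: finite_T)

lemma inj_on_decomposition: "Suc j \<le> L \<Longrightarrow> inj_on (\<lambda>(s, y). s + p * y) (T \<times> S j)"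
proof (rule inj_onI, clarsimp)
  fix s t x y assume *: "Suc j \<le> L" "s \<in> T" "t \<in> T" "x \<in> S j" "y \<in> S j" "s + p * x = t + p * y"
  then have "(s + p * x) - (t + p * y) \<in> I (Suc j)" by simp
  from decomposition_inj[OF *(2,3) this *(1)] show "s = t \<and> x = y"
    using S_eq * by auto
qed

lemma card_S: "j \<le> L \<Longrightarrow> card (S j) = q ^ j"
proof (induction j)
  case (Suc j)
  have "card (S (Suc j)) = card (T \<times> S j)"
    unfolding S.simps by (rule card_image[OF inj_on_decomposition[OF Suc.prems]])
  then show ?case using Suc by (simp add: card_cartesian_product)
qed simp

text \<open>Exactly one digit is congruent to \<open>- c\<close>. The shift \<open>c\<close> serves
  conditions such as \<open>x + u \<notin> I 1\<close> with \<open>x\<close> already chosen.\<close>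

lemma card_units_T: "card {s \<in> T. c + s \<notin> I 1} = q - 1"
proof -
  obtain t where t: "t \<in> T" "- c - t \<in> I 1" using T_ex by blast
  have "c + s \<in> I 1 \<longleftrightarrow> s = t" if "s \<in> T" for s
  proof
    assume "c + s \<in> I 1"
    then have "(c + s) + (- c - t) \<in> I 1" using t I_add by blast
    then show "s = t" using T_eq that t by simp
  next
    assume "s = t" then show "c + s \<in> I 1" using I_uminus[OF t(2)] by (simp add: add.commute)
  qed
  then have "{s \<in> T. c + s \<notin> I 1} = T - {t}" by auto
  then show ?thesis using t finite_T by simp
qed

text \<open>Only the leading digit decides whether the sum is a unit; the other \<open>j\<close>
  digits are free.\<close>

lemma card_units_S:
  assumes "Suc j \<le> L" shows "card {s \<in> S (Suc j). c + s \<notin> I 1} = (q - 1) * q ^ j"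
proof -
  have unit: "c + (s + p * y) \<in> I 1 \<longleftrightarrow> c + s \<in> I 1" for s y
    by (rule I_shift) simp
  have "{s \<in> S (Suc j). c + s \<notin> I 1} = (\<lambda>(s, y). s + p * y) ` ({s \<in> T. c + s \<notin> I 1} \<times> S j)"
    using unit by auto
  moreover have "inj_on (\<lambda>(s, y). s + p * y) ({s \<in> T. c + s \<notin> I 1} \<times> S j)"
    by (rule inj_on_subset[OF inj_on_decomposition[OF assms]]) auto
  ultimately show ?thesis
    using assms card_units_T card_S by (simp add: card_image card_cartesian_product)
qed

lemma q_ge_2: "2 \<le> q"
proof -
  have "card T \<noteq> 0" using T_ex finite_T by auto
  moreover have "card T \<noteq> 1"
  proof
    assume "card T = 1"
    then obtain t where "T = {t}" by (auto simp: card_1_singleton_iff)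
    then have "1 - t \<in> I 1" "0 - t \<in> I 1" using T_ex[of 1] T_ex[of 0] unfolding \<open>T = {t}\<close> by blast+
    then have "(1 - t) - (0 - t) \<in> I 1" by (rule I_diff)
    then show False by simp
  qed
  ultimately show ?thesis by linarith
qed

end

section \<open>Similarity of three by three matrices\<close>

definition mat3 :: "'a::zero \<Rightarrow> 'a \<Rightarrow> 'a \<Rightarrow> 'a \<Rightarrow> 'a \<Rightarrow> 'a \<Rightarrow> 'a \<Rightarrow> 'a \<Rightarrow> 'a \<Rightarrow> 'a ^ 3 ^ 3" where
  "mat3 a b c d e f g h i = vector [vector [a, b, c], vector [d, e, f], vector [g, h, i]]"

lemma mat3_nth [simp]:
  "mat3 a b c d e f g h i $ 1 $ 1 = a" "mat3 a b c d e f g h i $ 1 $ 2 = b"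
  "mat3 a b c d e f g h i $ 1 $ 3 = c" "mat3 a b c d e f g h i $ 2 $ 1 = d"
  "mat3 a b c d e f g h i $ 2 $ 2 = e" "mat3 a b c d e f g h i $ 2 $ 3 = f"
  "mat3 a b c d e f g h i $ 3 $ 1 = g" "mat3 a b c d e f g h i $ 3 $ 2 = h"
  "mat3 a b c d e f g h i $ 3 $ 3 = i"
  by (simp_all add: mat3_def)

lemmas matrix3_simps = vec_eq_iff forall_3 matrix_matrix_mult_def sum_3

lemma mat_nth3 [simp]:
  fixes c :: "'a::zero"
  shows "(mat c :: 'a ^ 3 ^ 3) $ 1 $ 1 = c" "(mat c :: 'a ^ 3 ^ 3) $ 1 $ 2 = 0"
    "(mat c :: 'a ^ 3 ^ 3) $ 1 $ 3 = 0" "(mat c :: 'a ^ 3 ^ 3) $ 2 $ 1 = 0"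
    "(mat c :: 'a ^ 3 ^ 3) $ 2 $ 2 = c" "(mat c :: 'a ^ 3 ^ 3) $ 2 $ 3 = 0"
    "(mat c :: 'a ^ 3 ^ 3) $ 3 $ 1 = 0" "(mat c :: 'a ^ 3 ^ 3) $ 3 $ 2 = 0"
    "(mat c :: 'a ^ 3 ^ 3) $ 3 $ 3 = c"
  by (simp_all add: mat_def)

lemma mat_mult_nth [simp]:
  fixes A :: "'a::comm_ring_1 ^ 3 ^ 3"
  shows "(mat c ** A) $ i $ j = c * A $ i $ j" "(A ** mat c) $ i $ j = c * A $ i $ j"
proof -
  have "\<forall>i j. (mat c ** A) $ i $ j = c * A $ i $ j" "\<forall>i j. (A ** mat c) $ i $ j = c * A $ i $ j"
    by (simp_all add: matrix3_simps mult.commute)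
  then show "(mat c ** A) $ i $ j = c * A $ i $ j" "(A ** mat c) $ i $ j = c * A $ i $ j"
    by simp_all
qed

lemma mat_commute:
  fixes A :: "'a::comm_ring_1 ^ 3 ^ 3"
  shows "A ** mat c = mat c ** A"
  by (simp add: vec_eq_iff)

text \<open>The adjugate, a substitute for the inverse of an intertwiner: products with it are exact
  identities over \<open>'a\<close>, and the unit determinant is cancelled only at the end.\<close>

definition adj3 :: "'a::comm_ring_1 ^ 3 ^ 3 \<Rightarrow> 'a ^ 3 ^ 3" where
  "adj3 X = mat3
     (X$2$2 * X$3$3 - X$2$3 * X$3$2) (X$1$3 * X$3$2 - X$1$2 * X$3$3) (X$1$2 * X$2$3 - X$1$3 * X$2$2)
     (X$2$3 * X$3$1 - X$2$1 * X$3$3) (X$1$1 * X$3$3 - X$1$3 * X$3$1) (X$1$3 * X$2$1 - X$1$1 * X$2$3)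
     (X$2$1 * X$3$2 - X$2$2 * X$3$1) (X$1$2 * X$3$1 - X$1$1 * X$3$2) (X$1$1 * X$2$2 - X$1$2 * X$2$1)"

lemma mult_adj3: "X ** adj3 X = mat (det X)" and adj3_mult: "adj3 X ** X = mat (det X)"
  by (simp_all add: adj3_def matrix3_simps det_3 algebra_simps)

definition tr3 :: "'a::comm_ring_1 ^ 3 ^ 3 \<Rightarrow> 'a" where
  "tr3 M = M$1$1 + M$2$2 + M$3$3"

lemma tr3_commute: "tr3 (A ** B) = tr3 (B ** A)"
  by (simp add: tr3_def matrix3_simps algebra_simps)

lemma mult_mult_adj3:
  fixes A X :: "'a::comm_ring_1 ^ 3 ^ 3"
  shows "A ** X ** adj3 X = mat (det X) ** A"
  unfolding matrix_mul_assoc[symmetric] mult_adj3 by (rule mat_commute)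

lemma matrix_mult_mat_left:
  fixes A B :: "'a::comm_ring_1 ^ 3 ^ 3"
  shows "(mat c ** A) ** B = mat c ** (A ** B)" "A ** (mat c ** B) = mat c ** (A ** B)"
  by (simp_all add: matrix_mul_assoc mat_commute)

context truncated_principal_local
begin

lemma I_cong_mult: "a - b \<in> I k \<Longrightarrow> c - d \<in> I k \<Longrightarrow> a * c - b * d \<in> I k"
  by (rule I_comb2[of "a - b" k "c - d" _ c b]) (simp_all add: algebra_simps)

lemma I_cong_add: "a - b \<in> I k \<Longrightarrow> c - d \<in> I k \<Longrightarrow> (a + c) - (b + d) \<in> I k"
  by (rule I_comb2[of "a - b" k "c - d" _ 1 1]) (simp_all add: algebra_simps)

lemma I_cong_diff: "a - b \<in> I k \<Longrightarrow> c - d \<in> I k \<Longrightarrow> (a - c) - (b - d) \<in> I k"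
  by (rule I_comb2[of "a - b" k "c - d" _ 1 "-1"]) (simp_all add: algebra_simps)

lemma I_sym: "a - b \<in> I k \<Longrightarrow> b - a \<in> I k"
  using I_uminus[of "a - b"] by simp

lemma I_trans: "a - b \<in> I k \<Longrightarrow> b - c \<in> I k \<Longrightarrow> a - c \<in> I k"
  using I_add[of "a - b" k "b - c"] by simp

definition mcong :: "nat \<Rightarrow> 'a ^ 3 ^ 3 \<Rightarrow> 'a ^ 3 ^ 3 \<Rightarrow> bool" where
  "mcong k A B \<longleftrightarrow> (\<forall>i j. A $ i $ j - B $ i $ j \<in> I k)"

text \<open>A matrix with determinant outside \<open>I 1\<close> is invertible modulo \<open>K\<close>, hence the notion of
  similarity modulo \<open>I k\<close> below is that of the quotient ring.\<close>

definition sim :: "nat \<Rightarrow> 'a ^ 3 ^ 3 \<Rightarrow> 'a ^ 3 ^ 3 \<Rightarrow> bool" where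
  "sim k M N \<longleftrightarrow> (\<exists>X. det X \<notin> I 1 \<and> mcong k (X ** M) (N ** X))"

definition scalar1 :: "'a ^ 3 ^ 3 \<Rightarrow> bool" where
  "scalar1 M \<longleftrightarrow> (\<exists>d. mcong 1 M (mat d))"

lemma mcong_refl [simp]: "mcong k A A"
  by (simp add: mcong_def)

lemma mcong_sym: "mcong k A B \<Longrightarrow> mcong k B A"
  unfolding mcong_def using I_sym by blast

lemma mcong_trans [trans]: "mcong k A B \<Longrightarrow> mcong k B C \<Longrightarrow> mcong k A C"
  unfolding mcong_def using I_trans by blast

lemma mcong_mono: "mcong k A B \<Longrightarrow> j \<le> k \<Longrightarrow> mcong j A B"
  unfolding mcong_def using I_antimono by blast

lemma mcong_add: "mcong k A B \<Longrightarrow> mcong k C D \<Longrightarrow> mcong k (A + C) (B + D)"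
  unfolding mcong_def using I_cong_add by simp

lemma mcong_diff: "mcong k A B \<Longrightarrow> mcong k C D \<Longrightarrow> mcong k (A - C) (B - D)"
  unfolding mcong_def using I_cong_diff by simp

lemma mcong_mult: "mcong k A B \<Longrightarrow> mcong k C D \<Longrightarrow> mcong k (A ** C) (B ** D)"
  unfolding mcong_def matrix_matrix_mult_def sum_3 by (simp add: I_cong_add I_cong_mult)

lemma mcong_det: "mcong k A B \<Longrightarrow> det A - det B \<in> I k"
  unfolding mcong_def det_3 by (intro I_cong_add I_cong_diff I_cong_mult) auto

lemma mcong_tr3: "mcong k A B \<Longrightarrow> tr3 A - tr3 B \<in> I k"
  unfolding mcong_def tr3_def by (intro I_cong_add) auto

lemma mcong_mat_cancel: "d \<notin> I 1 \<Longrightarrow> mcong k (mat d ** A) (mat d ** B) \<Longrightarrow> mcong k A B"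
  unfolding mcong_def using unit_cancel[of d] by (simp add: right_diff_distrib[symmetric])

lemma det_adj3_unit: "det X \<notin> I 1 \<Longrightarrow> det (adj3 X) \<notin> I 1"
proof
  assume X: "det X \<notin> I 1" and "det (adj3 X) \<in> I 1"
  then have "det (X ** adj3 X) \<in> I 1" by (simp add: det_mul I_mult)
  also have "det (X ** adj3 X) = det X * det X * det X" unfolding mult_adj3 by (simp add: det_3)
  finally show False using X I_prime by blast
qed

lemma sim_refl [simp]: "sim k M M"
  unfolding sim_def by (intro exI[of _ "mat 1"]) simp

lemma mcong_sim: "mcong k M N \<Longrightarrow> sim k M N"
  unfolding sim_def by (intro exI[of _ "mat 1"]) simp

lemma sim_trans [trans]: "sim k M N \<Longrightarrow> sim k N R \<Longrightarrow> sim k M R"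
proof -
  assume "sim k M N" "sim k N R"
  then obtain X Y where X: "det X \<notin> I 1" "mcong k (X ** M) (N ** X)"
    and Y: "det Y \<notin> I 1" "mcong k (Y ** N) (R ** Y)"
    unfolding sim_def by blast
  have "mcong k ((Y ** X) ** M) (Y ** (N ** X))"
    using mcong_mult[OF mcong_refl X(2)] by (simp add: matrix_mul_assoc)
  also have "mcong k (Y ** (N ** X)) (R ** (Y ** X))"
    using mcong_mult[OF Y(2) mcong_refl] by (simp add: matrix_mul_assoc)
  finally show ?thesis
    unfolding sim_def using X Y I_prime by (intro exI[of _ "Y ** X"]) (auto simp: det_mul)
qed

text \<open>Multiplying the intertwining relation by the adjugate of \<open>X\<close> on both sides
  leaves the factor \<open>det X\<close> on each side; once it is cancelled, the adjugate is an
  intertwiner in the other direction.\<close>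

lemma sim_sym: "sim k M N \<Longrightarrow> sim k N M"
proof -
  assume "sim k M N"
  then obtain X where X: "det X \<notin> I 1" "mcong k (X ** M) (N ** X)" unfolding sim_def by blast
  have "mat (det X) ** (adj3 X ** N) = adj3 X ** (N ** X) ** adj3 X"
    by (simp add: matrix_mul_assoc mult_mult_adj3)
  moreover have "mcong k (adj3 X ** (N ** X) ** adj3 X) (adj3 X ** (X ** M) ** adj3 X)"
    by (intro mcong_mult mcong_refl mcong_sym[OF X(2)])
  moreover have "adj3 X ** (X ** M) ** adj3 X = mat (det X) ** (M ** adj3 X)"
    by (simp add: matrix_mul_assoc adj3_mult)
  ultimately have "mcong k (adj3 X ** N) (M ** adj3 X)"
    using mcong_mat_cancel[OF X(1)] by metis
  then show ?thesis unfolding sim_def using det_adj3_unit X(1) by blast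
qed

lemma sim_det: "sim k M N \<Longrightarrow> det M - det N \<in> I k"
proof -
  assume "sim k M N"
  then obtain X where X: "det X \<notin> I 1" "mcong k (X ** M) (N ** X)" unfolding sim_def by blast
  have "det X * (det M - det N) \<in> I k"
    using mcong_det[OF X(2)] by (simp add: det_mul algebra_simps)
  then show ?thesis using X(1) unit_cancel by blast
qed

text \<open>The traces of \<open>adj3 X ** X ** M\<close> and \<open>adj3 X ** N ** X\<close> agree
  modulo \<open>I k\<close>, and by cyclicity they are \<open>det X\<close> times the traces of
  \<open>M\<close> and \<open>N\<close>.\<close>

lemma sim_tr3: "sim k M N \<Longrightarrow> tr3 M - tr3 N \<in> I k"
proof -
  assume "sim k M N"
  then obtain X where X: "det X \<notin> I 1" "mcong k (X ** M) (N ** X)" unfolding sim_def by blast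
  have "mcong k (adj3 X ** (X ** M)) (adj3 X ** (N ** X))" by (intro mcong_mult mcong_refl X)
  then have "tr3 (adj3 X ** (X ** M)) - tr3 (adj3 X ** (N ** X)) \<in> I k" by (rule mcong_tr3)
  moreover have "tr3 (adj3 X ** (X ** M)) = det X * tr3 M"
    by (simp add: matrix_mul_assoc adj3_mult tr3_def algebra_simps)
  moreover have "tr3 (adj3 X ** (N ** X)) = det X * tr3 N"
    by (subst tr3_commute) (simp add: matrix_mul_assoc[symmetric] mult_adj3 tr3_def algebra_simps)
  ultimately have "det X * (tr3 M - tr3 N) \<in> I k" by (simp add: right_diff_distrib)
  then show ?thesis using X(1) unit_cancel by blast
qed

text \<open>Together with \<open>sim_det\<close> this makes the determinants of all shifts
  invariant, which gives access to the coefficients of the characteristic polynomial.\<close>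

lemma sim_add_mat: "sim k M N \<Longrightarrow> sim k (M + mat c) (N + mat c)"
proof -
  assume "sim k M N"
  then obtain X where X: "det X \<notin> I 1" "mcong k (X ** M) (N ** X)" unfolding sim_def by blast
  have "mcong k (X ** M + X ** mat c) (N ** X + mat c ** X)"
    unfolding mat_commute by (intro mcong_add X mcong_refl)
  moreover have "N ** X + mat c ** X = (N + mat c) ** X"
    by (simp add: matrix3_simps algebra_simps)
  ultimately show ?thesis
    unfolding sim_def matrix_add_ldistrib using X(1) by (intro exI[of _ X]) simp
qed

text \<open>If \<open>f\<close> is the quadratic polynomial, then \<open>X f(M)\<close> is congruent
  to \<open>f(N) X\<close>. Hence \<open>f(N) X\<close> vanishes modulo \<open>I j\<close>, and the
  adjugate removes \<open>X\<close>.\<close>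

lemma sim_quadratic:
  assumes "sim k M N" "j \<le> k" "mcong j (M ** M - mat b ** M + mat c) 0"
  shows "mcong j (N ** N - mat b ** N + mat c) 0"
proof -
  obtain X where X: "det X \<notin> I 1" "mcong k (X ** M) (N ** X)"
    using assms(1) unfolding sim_def by blast
  then have XM: "mcong j (X ** M) (N ** X)" using mcong_mono assms(2) by blast
  have "mcong j (X ** (M ** M)) ((N ** X) ** M)"
    using mcong_mult[OF XM mcong_refl] by (simp add: matrix_mul_assoc)
  also have "mcong j ((N ** X) ** M) (N ** (N ** X))"
    using mcong_mult[OF mcong_refl XM] by (simp add: matrix_mul_assoc)
  finally have 1: "mcong j (X ** (M ** M)) ((N ** N) ** X)" by (simp add: matrix_mul_assoc)
  have 2: "mcong j (X ** (mat b ** M)) ((mat b ** N) ** X)"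
    using mcong_mult[OF mcong_refl XM] by (simp add: matrix_mult_mat_left)
  have "mcong j (X ** (M ** M) - X ** (mat b ** M) + X ** mat c)
      ((N ** N) ** X - (mat b ** N) ** X + mat c ** X)"
    by (intro mcong_add mcong_diff 1 2) (simp add: mat_commute)
  moreover have "X ** (M ** M) - X ** (mat b ** M) + X ** mat c = X ** (M ** M - mat b ** M + mat c)"
    by (simp add: matrix3_simps algebra_simps)
  moreover have "(N ** N) ** X - (mat b ** N) ** X + mat c ** X = (N ** N - mat b ** N + mat c) ** X"
    by (simp add: matrix3_simps algebra_simps)
  ultimately have "mcong j (X ** (M ** M - mat b ** M + mat c)) ((N ** N - mat b ** N + mat c) ** X)"
    by simp
  moreover have X0: "X ** 0 = 0" by (simp add: matrix3_simps)
  moreover have "mcong j (X ** (M ** M - mat b ** M + mat c)) (X ** 0)"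
    using mcong_mult[OF mcong_refl assms(3)] .
  ultimately have "mcong j ((N ** N - mat b ** N + mat c) ** X) 0"
    using mcong_sym mcong_trans unfolding X0 by blast
  then have "mcong j ((N ** N - mat b ** N + mat c) ** X ** adj3 X) (0 ** adj3 X)"
    by (rule mcong_mult) simp
  then have "mcong j (mat (det X) ** (N ** N - mat b ** N + mat c)) (mat (det X) ** 0)"
    unfolding mult_mult_adj3 by (simp add: matrix3_simps)
  then show ?thesis using mcong_mat_cancel X(1) by blast
qed

lemma simI: "det X \<notin> I 1 \<Longrightarrow> X ** M = N ** X \<Longrightarrow> sim k M N"
  unfolding sim_def by (intro exI[of _ X]) simp

end

section \<open>Normal forms of matrices that are not scalar modulo the maximal ideal\<close>

text \<open>If \<open>\<tau> = nf x u v z w - x\<close>, the basis is \<open>e\<close>, \<open>\<tau> e\<close>, \<open>f\<close>, with \<open>\<tau> f = z e\<close> and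
  \<open>\<tau>\<^sup>2 e = u \<tau> e + v e + w f\<close>.\<close>

definition nf :: "'a::comm_ring_1 \<Rightarrow> 'a \<Rightarrow> 'a \<Rightarrow> 'a \<Rightarrow> 'a \<Rightarrow> 'a ^ 3 ^ 3" where
  "nf x u v z w = mat3 x v z 1 (x + u) 0 0 w x"

lemma det_nf: "det (nf x u v z w) = x ^ 3 + u * x ^ 2 - v * x + z * w"
  by (simp add: nf_def det_3 power3_eq_cube power2_eq_square algebra_simps)

lemma tr3_nf: "tr3 (nf x u v z w) = 3 * x + u"
  by (simp add: nf_def tr3_def)

lemma nf_add_mat: "nf x u v z w + mat c = nf (x + c) u v z w"
  by (simp add: nf_def vec_eq_iff forall_3)

context truncated_principal_local
begin

lemma nf_cong:
  "x - x' \<in> I k \<Longrightarrow> u - u' \<in> I k \<Longrightarrow> v - v' \<in> I k \<Longrightarrow> z - z' \<in> I k \<Longrightarrow> w - w' \<in> I k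
    \<Longrightarrow> sim k (nf x u v z w) (nf x' u' v' z' w')"
  by (intro mcong_sim) (simp add: mcong_def forall_3 nf_def I_cong_add)

text \<open>The vector \<open>f\<close> is rescaled by the unit \<open>c\<close>, which multiplies
  \<open>z\<close> by \<open>c\<close> and divides \<open>w\<close> by it; \<open>c'\<close> inverts
  \<open>c\<close> only modulo \<open>I k\<close>.\<close>

lemma nf_scale:
  assumes "c \<notin> I 1" "c * c' - 1 \<in> I k"
  shows "sim k (nf x u v (c * z) (c' * w)) (nf x u v z w)"
proof -
  have "c * (c' * w) - w \<in> I k"
    by (rule I_comb1[OF assms(2), of _ w]) (simp add: algebra_simps)
  then have "mcong k (mat3 1 0 0 0 1 0 0 0 c ** nf x u v (c * z) (c' * w))
      (nf x u v z w ** mat3 1 0 0 0 1 0 0 0 c)"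
    by (simp add: mcong_def forall_3 nf_def matrix3_simps mult.commute)
  then show ?thesis
    unfolding sim_def using assms(1) by (intro exI[of _ "mat3 1 0 0 0 1 0 0 0 c"]) (simp add: det_3)
qed

text \<open>The next three lemmas replace \<open>e\<close> by \<open>e + c f\<close>, replace \<open>f\<close> by
  \<open>f + s \<tau> e + (s\<^sup>2 w - s u) e\<close>, and take \<open>f\<close> to be the old \<open>e\<close>, which is a cyclic vector if \<open>w\<close> is a
  unit.\<close>

lemma nf_move_c:
  "sim k (nf (x - c * z) (u + 3 * c * z) (v - 2 * c * z * u - 3 * c ^ 2 * z ^ 2) z
      (w - c * v + c ^ 2 * z * u + c ^ 3 * z ^ 2)) (nf x u v z w)"
  by (rule simI[of "mat3 1 (2 * c * z) 0 0 1 0 c (c ^ 2 * z) 1"])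
     (simp_all add: det_3 nf_def matrix3_simps power2_eq_square power3_eq_cube algebra_simps)

lemma nf_move_s:
  "sim k (nf (x + s * w) (u - 3 * s * w) (v + 2 * u * s * w - 3 * s ^ 2 * w ^ 2)
      (z + s * v + s ^ 2 * u * w - s ^ 3 * w ^ 2) w) (nf x u v z w)"
  by (rule simI[of "mat3 1 (- (s * w)) (s ^ 2 * w - s * u) 0 1 s 0 0 1"])
     (simp_all add: det_3 nf_def matrix3_simps power2_eq_square power3_eq_cube algebra_simps)

lemma nf_move_cyclic:
  "w \<notin> I 1 \<Longrightarrow> sim k (nf 0 (3 * x + u) (v - 3 * x ^ 2 - 2 * x * u) 1
      (x ^ 3 + u * x ^ 2 - v * x + z * w)) (nf x u v z w)"
  by (rule simI[of "mat3 x (x ^ 2 + v) 1 1 (2 * x + u) 0 0 w 0"])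
     (simp_all add: det_3 nf_def matrix3_simps power2_eq_square power3_eq_cube algebra_simps)

text \<open>The companion shape describes \<open>M\<close> in a basis \<open>e\<close>,
  \<open>M e\<close>, \<open>f\<close> with \<open>M f = c e + b M e + x f\<close>. Subtracting the
  scalar \<open>x\<close> removes the \<open>f\<close> term, and replacing \<open>f\<close> by
  \<open>f - b e\<close> removes the term \<open>b M e\<close>.\<close>

lemma nf_of_companion:
  "sim k (nf x (y - 2 * x) (a - x ^ 2 + y * x + w * b) (c + x * b) w) (mat3 0 a c 1 y b 0 w x)"
  by (rule simI[of "mat3 1 (- x) (- b) 0 1 0 0 0 1"])
     (simp_all add: det_3 nf_def matrix3_simps power2_eq_square power3_eq_cube algebra_simps)

text \<open>The columns of \<open>X\<close> form a basis \<open>e\<close>, \<open>M e\<close>,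
  \<open>f\<close>, in which \<open>M\<close> takes the companion shape modulo
  \<open>I k\<close>.\<close>

lemma companion_of_frame:
  assumes "det X \<notin> I 1" "\<forall>i. (M ** X) $ i $ 1 = X $ i $ 2"
  shows "\<exists>x u v z w. sim k (nf x u v z w) M"
proof -
  obtain d where d: "det X * d - 1 \<in> I k" using I_unit[OF assms(1)] by blast
  \<comment> \<open>The matrix of \<open>M\<close> in this basis, with
    \<open>mat d ** adj3 X\<close> as inverse of \<open>X\<close> modulo \<open>I k\<close>.\<close>
  define C where "C = mat d ** (adj3 X ** (M ** X))"
  have "X ** C = mat (det X * d) ** (M ** X)"
    unfolding C_def matrix_mult_mat_left by (simp add: matrix_mul_assoc mult_adj3 vec_eq_iff) 
      (simp add: matrix3_simps algebra_simps)
  moreover have "mcong k (mat (det X * d) ** (M ** X)) (M ** X)"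
    unfolding mcong_def mat_mult_nth using I_mult_right[OF d] by (simp add: left_diff_distrib)
  ultimately have C: "mcong k (X ** C) (M ** X)" by simp
  \<comment> \<open>The first column of \<open>C\<close> is the second unit vector only up to
    congruence. It is made exact so that \<open>nf_of_companion\<close> applies.\<close>
  define C' where "C' = mat3 0 (C$1$2) (C$1$3) 1 (C$2$2) (C$2$3) 0 (C$3$2) (C$3$3)"
  have "(X ** C') $ i $ 1 = X $ i $ 2" "(X ** C') $ i $ 2 = (X ** C) $ i $ 2"
    "(X ** C') $ i $ 3 = (X ** C) $ i $ 3" for i
    by (simp_all add: C'_def matrix_matrix_mult_def sum_3)
  then have "mcong k (X ** C') (M ** X)"
    using C assms(2) unfolding mcong_def forall_3 by simp
  then have "sim k C' M" unfolding sim_def using assms(1) by blast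
  then show ?thesis unfolding C'_def using nf_of_companion sim_trans by blast
qed

text \<open>Otherwise \<open>e\<close>, \<open>M e\<close>, \<open>f\<close> never has unit
  determinant. Taking unit vectors for \<open>e\<close> then puts the off-diagonal entries into
  \<open>I 1\<close>, and the sum of the first unit vector with each of the other two makes the
  diagonal entries congruent, so that \<open>M\<close> is scalar modulo \<open>I 1\<close>.\<close>

lemma nonscalar_sim_nf:
  assumes "\<not> scalar1 M"
  shows "\<exists>x u v z w. sim k (nf x u v z w) M"
proof (rule ccontr)
  assume *: "\<not> ?thesis"
  have X: "det X \<in> I 1" if "\<forall>i. (M ** X) $ i $ 1 = X $ i $ 2" for X
    using that * companion_of_frame by blast
  have 21: "M$2$1 \<in> I 1"
    using X[of "mat3 1 (M$1$1) 0 0 (M$2$1) 0 0 (M$3$1) 1"] by (simp add: det_3 matrix3_simps)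
  have 31: "M$3$1 \<in> I 1"
    using X[of "mat3 1 (M$1$1) 0 0 (M$2$1) 1 0 (M$3$1) 0"]
    by (simp add: det_3 matrix3_simps)
  have 12: "M$1$2 \<in> I 1"
    using X[of "mat3 0 (M$1$2) 0 1 (M$2$2) 0 0 (M$3$2) 1"]
    by (simp add: det_3 matrix3_simps)
  have 32: "M$3$2 \<in> I 1"
    using X[of "mat3 0 (M$1$2) 1 1 (M$2$2) 0 0 (M$3$2) 0"] by (simp add: det_3 matrix3_simps)
  have 13: "M$1$3 \<in> I 1"
    using X[of "mat3 0 (M$1$3) 0 0 (M$2$3) 1 1 (M$3$3) 0"] by (simp add: det_3 matrix3_simps)
  have 23: "M$2$3 \<in> I 1"
    using X[of "mat3 0 (M$1$3) 1 0 (M$2$3) 0 1 (M$3$3) 0"]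
    by (simp add: det_3 matrix3_simps)
  have "(M$2$1 + M$2$2) - (M$1$1 + M$1$2) \<in> I 1"
    using X[of "mat3 1 (M$1$1 + M$1$2) 0 1 (M$2$1 + M$2$2) 0 0 (M$3$1 + M$3$2) 1"]
    by (simp add: det_3 matrix3_simps)
  from I_comb3[OF this 21 12, of _ 1 "-1" 1] have 22: "M$2$2 - M$1$1 \<in> I 1" by simp
  have "(M$1$1 + M$1$3) - (M$3$1 + M$3$3) \<in> I 1"
    using X[of "mat3 1 (M$1$1 + M$1$3) 0 0 (M$2$1 + M$2$3) 1 1 (M$3$1 + M$3$3) 0"]
    by (simp add: det_3 matrix3_simps)
  from I_comb3[OF this 31 13, of _ "-1" "-1" 1] have 33: "M$3$3 - M$1$1 \<in> I 1" by simp
  have "mcong 1 M (mat (M$1$1))"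
    using 21 31 12 32 13 23 22 33 by (simp add: mcong_def forall_3)
  then show False using assms unfolding scalar1_def by blast
qed

section \<open>Two families of representatives and the reduction to them\<close>

definition params_I :: "nat \<Rightarrow> (nat \<times> 'a \<times> 'a \<times> 'a \<times> 'a) set" where
  "params_I k = (SIGMA m:{..k}. S m \<times> S k \<times> S (k - m) \<times> S (k - m))"

text \<open>The family with \<open>z = p ^ m\<close>. Here \<open>x\<close> counts only modulo
  \<open>p ^ m\<close>, and the factor \<open>p ^ m\<close> leaves \<open>k - m\<close> relevant
  digits to \<open>v\<close> and \<open>w\<close>. The value \<open>m = k\<close> covers the case
  that \<open>v\<close>, \<open>z\<close> and \<open>w\<close> all vanish modulo
  \<open>I k\<close>.\<close>

definition nf_I :: "nat \<times> 'a \<times> 'a \<times> 'a \<times> 'a \<Rightarrow> 'a ^ 3 ^ 3" where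
  "nf_I = (\<lambda>(m, x, u, v, w). nf x u (p ^ m * v) (p ^ m) (p ^ m * w))"

text \<open>The family with \<open>w = p ^ m\<close>. It has no member with \<open>m = 0\<close>,
  where a unit \<open>w\<close> provides a cyclic vector, nor with \<open>m = k\<close>, which
  belongs to the first family. The factors \<open>p\<close> and \<open>p ^ Suc m\<close> in
  \<open>nf_II\<close> account for the shorter digit lengths.\<close>

definition params_II :: "nat \<Rightarrow> (nat \<times> 'a \<times> 'a \<times> 'a \<times> 'a) set" where
  "params_II k = (SIGMA m:{1..<k}. S m \<times> S (k - 1) \<times> S (k - m - 1) \<times> S (k - m - 1))"

definition nf_II :: "nat \<times> 'a \<times> 'a \<times> 'a \<times> 'a \<Rightarrow> 'a ^ 3 ^ 3" where
  "nf_II = (\<lambda>(m, x, u, v, z). nf x (p * u) (p ^ Suc m * v) (p ^ Suc m * z) (p ^ m))"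

definition reps_I :: "nat \<Rightarrow> ('a ^ 3 ^ 3) set" where
  "reps_I k = nf_I ` params_I k"

definition reps_II :: "nat \<Rightarrow> ('a ^ 3 ^ 3) set" where
  "reps_II k = nf_II ` params_II k"

lemma power_cong: "m \<le> k \<Longrightarrow> v - v' \<in> I (k - m) \<Longrightarrow> p ^ m * v - p ^ m * v' \<in> I k"
  using I_power_mult[of "v - v'" "k - m" m] by (simp add: right_diff_distrib)

lemma reps_I_of_congruent:
  assumes "m \<le> k" "x - x0 \<in> I k" "x0 \<in> S m"
  shows "\<exists>R\<in>reps_I k. sim k R (nf x u (p ^ m * v) (p ^ m) (p ^ m * w))"
proof -
  obtain u0 v0 w0 where *: "u0 \<in> S k" "u - u0 \<in> I k" "v0 \<in> S (k - m)" "v - v0 \<in> I (k - m)"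
    "w0 \<in> S (k - m)" "w - w0 \<in> I (k - m)"
    using S_ex by metis
  then have "nf x0 u0 (p ^ m * v0) (p ^ m) (p ^ m * w0) \<in> reps_I k"
    unfolding reps_I_def using assms
    by (intro image_eqI[of _ _ "(m, x0, u0, v0, w0)"]) (simp_all add: nf_I_def params_I_def)
  moreover have "sim k (nf x u (p ^ m * v) (p ^ m) (p ^ m * w))
      (nf x0 u0 (p ^ m * v0) (p ^ m) (p ^ m * w0))"
    using * assms by (intro nf_cong power_cong) simp_all
  ultimately show ?thesis using sim_sym by blast
qed

text \<open>First \<open>f\<close> is rescaled so that \<open>z\<close> becomes
  \<open>p ^ m\<close>; for \<open>m = k\<close> both values vanish modulo \<open>I k\<close>. Then
  \<open>nf_move_c\<close> translates \<open>x\<close> by a multiple of \<open>p ^ m\<close> to its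
  representative, keeping \<open>v\<close> and \<open>w\<close> divisible by
  \<open>p ^ m\<close>.\<close>

lemma reduce_I:
  assumes "m \<le> k" "z \<notin> I 1 \<or> m = k"
  shows "\<exists>R\<in>reps_I k. sim k R (nf x u (p ^ m * v) (p ^ m * z) (p ^ m * w))"
proof -
  have "\<exists>w1. sim k (nf x u (p ^ m * v) (p ^ m) (p ^ m * w1))
      (nf x u (p ^ m * v) (p ^ m * z) (p ^ m * w))"
  proof (cases "m = k")
    case True
    then show ?thesis
      using power_mult_in[of k 1] power_mult_in[of k z]
      by (intro exI[of _ w] nf_cong) (auto intro: I_diff)
  next
    case False
    then obtain c where c: "\<And>k. z * c - 1 \<in> I k" using assms(2) I_unit by blast
    then have "c \<notin> I 1" using I_shift[OF c] I_mult one_not_in by (metis One_nat_def)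
    from nf_scale[OF this, of z k x u "p ^ m * v" "p ^ m * z" "p ^ m * w"] c
    have "sim k (nf x u (p ^ m * v) (c * (p ^ m * z)) (z * (p ^ m * w)))
        (nf x u (p ^ m * v) (p ^ m * z) (p ^ m * w))" by (simp add: mult.commute)
    moreover have "p ^ m - c * (p ^ m * z) \<in> I k"
      by (rule I_comb1[OF c, of _ "- (p ^ m)"]) (simp add: algebra_simps)
    then have "sim k (nf x u (p ^ m * v) (p ^ m) (p ^ m * (z * w)))
        (nf x u (p ^ m * v) (c * (p ^ m * z)) (z * (p ^ m * w)))"
      by (intro nf_cong) (simp_all add: algebra_simps)
    ultimately show ?thesis using sim_trans by blast
  qed
  then obtain w1 where w1: "sim k (nf x u (p ^ m * v) (p ^ m) (p ^ m * w1))
      (nf x u (p ^ m * v) (p ^ m * z) (p ^ m * w))" by blast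
  obtain x0 where x0: "x0 \<in> S m" "x - x0 \<in> I m" using S_ex by blast
  then obtain c where c: "\<And>k. x - x0 - p ^ m * c \<in> I k" using I_obtain by blast
  define v2 where "v2 = v - 2 * c * u - 3 * c ^ 2 * p ^ m"
  define w2 where "w2 = w1 - c * v + c ^ 2 * u + c ^ 3 * p ^ m"
  have "sim k (nf (x - c * p ^ m) (u + 3 * c * p ^ m) (p ^ m * v2) (p ^ m) (p ^ m * w2))
      (nf x u (p ^ m * v) (p ^ m) (p ^ m * w1))"
    using nf_move_c[of k x c "p ^ m" u "p ^ m * v" "p ^ m * w1"]
    by (simp add: v2_def w2_def power2_eq_square algebra_simps)
  moreover have "x - c * p ^ m - x0 \<in> I k" using c[of k] by (simp add: algebra_simps)
  ultimately show ?thesis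
    using reps_I_of_congruent[OF assms(1) _ x0(1)] w1 sim_trans by meson
qed

text \<open>The move \<open>nf_move_s\<close> with \<open>s = 1\<close> turns the cofactor
  \<open>z\<close> into the expression assumed to be a unit.\<close>

lemma reduce_I_after_move_s:
  assumes "m \<le> k" "z + v + u * w - p ^ m * w ^ 2 \<notin> I 1"
  shows "\<exists>R\<in>reps_I k. sim k R (nf x u (p ^ m * v) (p ^ m * z) (p ^ m * w))"
proof -
  have "sim k (nf (x + p ^ m * w) (u - 3 * (p ^ m * w))
        (p ^ m * (v + 2 * u * w - 3 * w ^ 2 * p ^ m))
        (p ^ m * (z + v + u * w - p ^ m * w ^ 2)) (p ^ m * w))
      (nf x u (p ^ m * v) (p ^ m * z) (p ^ m * w))"
    using nf_move_s[of k x 1 "p ^ m * w" u "p ^ m * v" "p ^ m * z"]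
    by (simp add: power2_eq_square algebra_simps)
  then show ?thesis using reduce_I[OF assms(1)] assms(2) sim_trans by meson
qed

text \<open>The roles of \<open>z\<close> and \<open>w\<close> are exchanged: rescaling gives
  \<open>w = p ^ m\<close>, and \<open>nf_move_s\<close> then translates \<open>x\<close> by a
  multiple of \<open>p ^ m\<close>.\<close>

lemma reduce_II:
  assumes "1 \<le> m" "m < k" "u \<in> I 1" "w \<notin> I 1"
  shows "\<exists>R\<in>reps_II k. sim k R (nf x u (p ^ Suc m * v) (p ^ Suc m * z) (p ^ m * w))"
proof -
  \<comment> \<open>With \<open>n = m - 1\<close>, the corrections \<open>p ^ m\<close> and
    \<open>p ^ (2 * m)\<close> are \<open>p * p ^ n\<close> and \<open>p ^ Suc m * p ^ n\<close>; so
    the move preserves the divisibility of \<open>u\<close>, \<open>v\<close> and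
    \<open>z\<close>.\<close>
  obtain n where n: "m = Suc n" using assms(1) by (cases m) auto
  obtain c where c: "\<And>k. w * c - 1 \<in> I k" using assms(4) I_unit by blast
  obtain u1 where u1: "\<And>k. u - p * u1 \<in> I k" using I_obtain[OF assms(3)] by auto
  obtain x0 where x0: "x0 \<in> S m" "x - x0 \<in> I m" using S_ex by blast
  then obtain s where s: "\<And>k. x - x0 - p ^ m * s \<in> I k" using I_obtain by blast
  define z1 where "z1 = w * z"
  have "p ^ m - c * (p ^ m * w) \<in> I k"
    by (rule I_comb1[OF c, of _ "- (p ^ m)"]) (simp add: algebra_simps)
  then have "sim k (nf x (p * u1) (p ^ Suc m * v) (p ^ Suc m * z1) (p ^ m))
      (nf x u (p ^ Suc m * v) (w * (p ^ Suc m * z)) (c * (p ^ m * w)))"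
    using I_sym[OF u1] by (intro nf_cong) (simp_all add: z1_def algebra_simps)
  also have "sim k (nf x u (p ^ Suc m * v) (w * (p ^ Suc m * z)) (c * (p ^ m * w)))
      (nf x u (p ^ Suc m * v) (p ^ Suc m * z) (p ^ m * w))"
    using c by (intro nf_scale[OF assms(4)])
  finally have 1: "sim k (nf x (p * u1) (p ^ Suc m * v) (p ^ Suc m * z1) (p ^ m))
      (nf x u (p ^ Suc m * v) (p ^ Suc m * z) (p ^ m * w))" .
  define u2 where "u2 = u1 + 3 * s * p ^ n"
  define v2 where "v2 = v - 2 * u1 * s - 3 * s ^ 2 * p ^ n"
  define z2 where "z2 = z1 - s * v + s ^ 2 * u1 + s ^ 3 * p ^ n"
  have 2: "sim k (nf (x - s * p ^ m) (p * u2) (p ^ Suc m * v2) (p ^ Suc m * z2) (p ^ m))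
      (nf x (p * u1) (p ^ Suc m * v) (p ^ Suc m * z1) (p ^ m))"
    using nf_move_s[of k x "- s" "p ^ m" "p * u1" "p ^ Suc m * v" "p ^ Suc m * z1"]
    by (simp add: u2_def v2_def z2_def n power2_eq_square power3_eq_cube algebra_simps)
  obtain u0 v0 z0 where *: "u0 \<in> S (k - 1)" "u2 - u0 \<in> I (k - 1)"
    "v0 \<in> S (k - m - 1)" "v2 - v0 \<in> I (k - m - 1)"
    "z0 \<in> S (k - m - 1)" "z2 - z0 \<in> I (k - m - 1)"
    using S_ex by metis
  have "p * u2 - p * u0 \<in> I k" using power_cong[of 1 k u2 u0] * assms by simp
  moreover have "x - s * p ^ m - x0 \<in> I k" using s[of k] by (simp add: algebra_simps)
  ultimately have 3: "sim k (nf (x - s * p ^ m) (p * u2) (p ^ Suc m * v2) (p ^ Suc m * z2) (p ^ m))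
      (nf x0 (p * u0) (p ^ Suc m * v0) (p ^ Suc m * z0) (p ^ m))"
    using * assms by (intro nf_cong power_cong) simp_all
  have "nf x0 (p * u0) (p ^ Suc m * v0) (p ^ Suc m * z0) (p ^ m) \<in> reps_II k"
    unfolding reps_II_def using * x0 assms
    by (intro image_eqI[of _ _ "(m, x0, u0, v0, z0)"]) (simp_all add: nf_II_def params_II_def)
  then show ?thesis using 1 2 3 sim_sym sim_trans by meson
qed

text \<open>The exponent \<open>m\<close> is the largest one up to \<open>k\<close> for which all
  three elements lie in \<open>I m\<close>; if all three cofactors were in \<open>I 1\<close>, it
  could be increased unless \<open>m = k\<close>.\<close>

lemma common_power:
  "\<exists>m\<le>k. \<exists>v1 z1 w1. v - p ^ m * v1 \<in> I k \<and> z - p ^ m * z1 \<in> I k \<and> w - p ^ m * w1 \<in> I k \<and>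
    (m = k \<or> v1 \<notin> I 1 \<or> z1 \<notin> I 1 \<or> w1 \<notin> I 1)"
proof -
  define P where "P m \<longleftrightarrow> v \<in> I m \<and> z \<in> I m \<and> w \<in> I m" for m
  define m where "m = Max {m. m \<le> k \<and> P m}"
  have fin: "finite {m. m \<le> k \<and> P m}" by simp
  have "0 \<in> {m. m \<le> k \<and> P m}" by (simp add: P_def)
  then have "m \<in> {m. m \<le> k \<and> P m}" unfolding m_def by (intro Max_in[OF fin]) blast
  then have m: "m \<le> k" "P m" by auto
  have Max: "i \<le> m" if "i \<le> k" "P i" for i
    unfolding m_def using that by (intro Max_ge[OF fin]) simp
  obtain v1 z1 w1 where *: "\<And>k. v - p ^ m * v1 \<in> I k" "\<And>k. z - p ^ m * z1 \<in> I k"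
    "\<And>k. w - p ^ m * w1 \<in> I k"
    using m(2) I_obtain unfolding P_def by metis
  have "m = k" if "v1 \<in> I 1" "z1 \<in> I 1" "w1 \<in> I 1"
  proof -
    have "p ^ m * v1 \<in> I (Suc m)" "p ^ m * z1 \<in> I (Suc m)" "p ^ m * w1 \<in> I (Suc m)"
      using I_power_mult[of _ 1 m] that by simp_all
    then have "P (Suc m)" unfolding P_def using I_shift[OF *(1)] I_shift[OF *(2)] I_shift[OF *(3)] by blast
    then show ?thesis using Max[of "Suc m"] m(1) by fastforce
  qed
  then show ?thesis using m(1) * by blast
qed

lemma nf_sim_rep: "\<exists>R\<in>reps_I k \<union> reps_II k. sim k R (nf x u v z w)"
proof -
  obtain m v1 z1 w1 where m: "m \<le> k" and *: "v - p ^ m * v1 \<in> I k" "z - p ^ m * z1 \<in> I k"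
    "w - p ^ m * w1 \<in> I k" and unit: "m = k \<or> v1 \<notin> I 1 \<or> z1 \<notin> I 1 \<or> w1 \<notin> I 1"
    using common_power by blast
  have 0: "sim k (nf x u (p ^ m * v1) (p ^ m * z1) (p ^ m * w1)) (nf x u v z w)"
    using * I_sym by (intro nf_cong) simp_all
  have "\<exists>R\<in>reps_I k \<union> reps_II k. sim k R (nf x u (p ^ m * v1) (p ^ m * z1) (p ^ m * w1))"
  proof (cases "z1 \<notin> I 1 \<or> m = k")
    case True
    then show ?thesis using reduce_I[OF m] by blast
  next
    case z1: False
    show ?thesis
    proof (cases "m = 0")
      case True
      show ?thesis
      proof (cases "w1 \<in> I 1")
        case False
        \<comment> \<open>With \<open>m = 0\<close> and \<open>w1\<close> a unit, the cyclic vector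
          gives a form with \<open>z = 1\<close>.\<close>
        from nf_move_cyclic[OF this, of k x u v1 z1]
        moreover have "\<exists>R\<in>reps_I k. sim k R (nf 0 (3 * x + u) (v1 - 3 * x ^ 2 - 2 * x * u) 1
            (x ^ 3 + u * x ^ 2 - v1 * x + z1 * w1))"
          using reduce_I[of 0 k 1 0 "3 * x + u" "v1 - 3 * x ^ 2 - 2 * x * u"
              "x ^ 3 + u * x ^ 2 - v1 * x + z1 * w1"] by simp
        ultimately show ?thesis using sim_trans unfolding True by (simp only: power_0 mult_1_left) blast
      next
        case w1: True
        then have v1: "v1 \<notin> I 1" using z1 unit by blast
        \<comment> \<open>The only unit is \<open>v1\<close>; the move with \<open>s = 1\<close>
          carries it to the position of \<open>z\<close>.\<close>
        have "(z1 + v1 + u * w1 - p ^ m * w1 ^ 2) - v1 \<in> I 1"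
          using z1 w1 by -
            (rule I_comb2[of z1 1 w1 _ 1 "u - p ^ m * w1"],
             simp_all add: power2_eq_square algebra_simps)
        then show ?thesis using reduce_I_after_move_s[OF m] v1 I_shift by blast
      qed
    next
      case False
      then have m1: "1 \<le> m" by simp
      then have pm: "p ^ m \<in> I 1" using I_antimono[OF power_mult_in[of m 1], of 1] by simp
      consider "v1 \<notin> I 1" | "v1 \<in> I 1" "w1 \<notin> I 1" "u \<notin> I 1" | "v1 \<in> I 1" "w1 \<notin> I 1" "u \<in> I 1"
        using unit z1 by blast
      then show ?thesis
      proof cases
        case 1
        obtain d where d: "\<And>k. v1 * d - 1 \<in> I k" using I_unit[OF 1] by blast
        \<comment> \<open>Since \<open>w1\<close> may be a unit and could cancel \<open>v1\<close>,
          \<open>nf_move_c\<close> with \<open>c = w1 / v1\<close> first brings the cofactor of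
          \<open>w\<close> into \<open>I 1\<close>. After that, \<open>s = 1\<close> makes the
          cofactor of \<open>z\<close> congruent to the unit \<open>v1\<close>.\<close>
        define c where "c = w1 * d"
        define v2 where "v2 = v1 - 2 * c * z1 * u - 3 * c ^ 2 * z1 ^ 2 * p ^ m"
        define w2 where "w2 = w1 - c * v1 + c ^ 2 * z1 * u + c ^ 3 * z1 ^ 2 * p ^ m"
        define u2 where "u2 = u + 3 * c * (p ^ m * z1)"
        have "sim k (nf (x - c * (p ^ m * z1)) u2 (p ^ m * v2) (p ^ m * z1) (p ^ m * w2))
            (nf x u (p ^ m * v1) (p ^ m * z1) (p ^ m * w1))"
          using nf_move_c[of k x c "p ^ m * z1" u "p ^ m * v1" "p ^ m * w1"]
          by (simp add: u2_def v2_def w2_def power2_eq_square algebra_simps)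
        moreover have "v2 - v1 \<in> I 1"
          using z1 by -
            (rule I_comb1[of z1 1 _ "- 2 * c * u - 3 * c ^ 2 * z1 * p ^ m"],
             simp_all add: v2_def power2_eq_square algebra_simps)
        moreover have w2: "w2 \<in> I 1"
          using z1 d[of 1] by -
            (rule I_comb2[of z1 1 "v1 * d - 1" _ "c ^ 2 * u + c ^ 3 * z1 * p ^ m" "- w1"],
             simp_all add: w2_def c_def power2_eq_square algebra_simps)
        moreover have "(z1 + v2 + u2 * w2 - p ^ m * w2 ^ 2) - v2 \<in> I 1"
          using z1 w2 by -
            (rule I_comb2[of z1 1 w2 _ 1 "u2 - p ^ m * w2"],
             simp_all add: power2_eq_square algebra_simps)
        ultimately show ?thesis
          using reduce_I_after_move_s[OF m] 1 I_shift sim_trans by (meson UnI1)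
      next
        case 2
        \<comment> \<open>Every term except the unit \<open>u * w1\<close> lies in
          \<open>I 1\<close>.\<close>
        have "(z1 + v1 + u * w1 - p ^ m * w1 ^ 2) - u * w1 \<in> I 1"
          using z1 2 pm by -
            (rule I_comb3[of z1 1 v1 "p ^ m" _ 1 1 "- (w1 ^ 2)"],
             simp_all add: power2_eq_square algebra_simps)
        then have "z1 + v1 + u * w1 - p ^ m * w1 ^ 2 \<notin> I 1" using 2 I_shift I_prime by blast
        then show ?thesis using reduce_I_after_move_s[OF m] by blast
      next
        case 3
        obtain v2 z2 where v2: "\<And>k. v1 - p * v2 \<in> I k" and z2: "\<And>k. z1 - p * z2 \<in> I k"
          using 3 z1 I_obtain[of _ 1] by (metis power_one_right)
        have "sim k (nf x u (p ^ Suc m * v2) (p ^ Suc m * z2) (p ^ m * w1))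
            (nf x u (p ^ m * v1) (p ^ m * z1) (p ^ m * w1))"
          using I_mult[OF I_sym[OF v2], of "p ^ m"] I_mult[OF I_sym[OF z2], of "p ^ m"]
          by (intro nf_cong) (simp_all add: algebra_simps)
        moreover have "\<exists>R\<in>reps_II k. sim k R (nf x u (p ^ Suc m * v2) (p ^ Suc m * z2) (p ^ m * w1))"
          using reduce_II[OF m1] m z1 3 by simp
        ultimately show ?thesis using sim_trans by (meson UnI2)
      qed
    qed
  qed
  then show ?thesis using 0 sim_trans by blast
qed


lemma sim_mcong_mat: "sim k M N \<Longrightarrow> 1 \<le> k \<Longrightarrow> mcong 1 M (mat d) \<Longrightarrow> mcong 1 N (mat d)"
proof -
  assume "sim k M N" "1 \<le> k" and d: "mcong 1 M (mat d)"
  then obtain X :: "'a ^ 3 ^ 3" where X: "det X \<notin> I 1" "mcong 1 (X ** M) (N ** X)"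
    unfolding sim_def using mcong_mono by blast
  have "mcong 1 (N ** X ** adj3 X) (X ** M ** adj3 X)"
    using mcong_mult[OF mcong_sym[OF X(2)] mcong_refl] .
  also have "mcong 1 (X ** M ** adj3 X) (X ** mat d ** adj3 X)"
    by (intro mcong_mult d mcong_refl)
  finally have "mcong 1 (mat (det X) ** N) (mat (det X) ** mat d)"
    unfolding mult_mult_adj3 mat_commute[of X d] by (simp only: mult_mult_adj3)
  then show ?thesis using mcong_mat_cancel X(1) by blast
qed

section \<open>Uniqueness of the normal forms\<close>

text \<open>The powers of \<open>p\<close> dividing \<open>v\<close>, \<open>z\<close> and \<open>w\<close> are those modulo which the matrix satisfies a
  monic quadratic equation.\<close>

lemma sim_nf_depth:
  assumes sim: "sim k (nf x u v z w) (nf x' u' v' z' w')" and "m \<le> k"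
    and in_I: "v \<in> I m" "z \<in> I m" "w \<in> I m"
  shows "v' \<in> I m" "z' \<in> I m" "w' \<in> I m" "x - x' \<in> I m"
proof -
  \<comment> \<open>Modulo \<open>p ^ m\<close> one has \<open>\<tau>\<^sup>2 = u \<tau>\<close>;
    written in terms of \<open>x + \<tau>\<close>, this is the quadratic equation used here.\<close>
  define Q where "Q = nf x' u' v' z' w' ** nf x' u' v' z' w' - mat (2 * x + u) ** nf x' u' v' z' w'
    + mat (x * (x + u))"
  have "mcong m (nf x u v z w ** nf x u v z w - mat (2 * x + u) ** nf x u v z w + mat (x * (x + u))) 0"
    using in_I by (simp add: mcong_def forall_3 nf_def matrix3_simps algebra_simps I_mult)
  then have "mcong m Q 0"
    unfolding Q_def by (rule sim_quadratic[OF sim \<open>m \<le> k\<close>])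
  then have Q: "Q $ i $ j \<in> I m" for i j by (simp add: mcong_def)
  have "Q $ 1 $ 1 - Q $ 3 $ 3 = v'" "Q $ 2 $ 3 = z'" "Q $ 3 $ 1 = w'"
    and Q21: "Q $ 2 $ 1 = 2 * x' + u' - (2 * x + u)"
    by (simp_all add: Q_def nf_def matrix3_simps algebra_simps)
  then show "v' \<in> I m" "z' \<in> I m" "w' \<in> I m"
    using Q I_diff by metis+
  \<comment> \<open>The trace compares \<open>3 * x + u\<close>, and entry (2,1) of \<open>Q\<close>
    compares \<open>2 * x + u\<close>; the difference is \<open>x\<close>.\<close>
  have "(3 * x + u) - (3 * x' + u') \<in> I m"
    using I_antimono[OF sim_tr3[OF sim] \<open>m \<le> k\<close>] by (simp add: tr3_nf)
  from I_add[OF this Q[of 2 1]] show "x - x' \<in> I m"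
    unfolding Q21 by (simp add: algebra_simps)
qed

text \<open>With a common \<open>x\<close>, the trace gives \<open>u\<close>, while the determinants
  of the shifts by \<open>- x\<close> and \<open>1 - x\<close> are \<open>z * w\<close> and
  \<open>1 + u - v + z * w\<close>.\<close>

lemma sim_nf_invariants:
  assumes "sim k (nf x u v z w) (nf x u' v' z' w')"
  shows "u - u' \<in> I k" "v - v' \<in> I k" "z * w - z' * w' \<in> I k"
proof -
  show u: "u - u' \<in> I k" using sim_tr3[OF assms] by (simp add: tr3_nf)
  show zw: "z * w - z' * w' \<in> I k"
    using sim_det[OF sim_add_mat[OF assms, of "- x"]] by (simp add: nf_add_mat det_nf)
  have "(1 + u - v + z * w) - (1 + u' - v' + z' * w') \<in> I k"
    using sim_det[OF sim_add_mat[OF assms, of "1 - x"]] by (simp add: nf_add_mat det_nf)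
  from I_comb3[OF this u zw, of _ "-1" 1 1] show "v - v' \<in> I k" by (simp add: algebra_simps)
qed

text \<open>Entries of the intertwining relation, labelled \<open>Eij\<close> by position in later
  proofs. The common scalar \<open>x\<close> cancels from them.\<close>

lemma sim_nf_obtain:
  assumes "sim k (nf x u v z w) (nf x u' v' z' w')"
  obtains X :: "'a ^ 3 ^ 3" where "det X \<notin> I 1"
    "X$1$2 - (v' * X$2$1 + z' * X$3$1) \<in> I k"
    "X$2$2 - (X$1$1 + u' * X$2$1) \<in> I k"
    "X$3$2 - w' * X$2$1 \<in> I k"
    "v * X$1$1 + u * X$1$2 + w * X$1$3 - (v' * X$2$2 + z' * X$3$2) \<in> I k"
    "v * X$3$1 + u * X$3$2 + w * X$3$3 - w' * X$2$2 \<in> I k"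
    "z * X$1$1 - (v' * X$2$3 + z' * X$3$3) \<in> I k"
    "z * X$2$1 - (X$1$3 + u' * X$2$3) \<in> I k"
    "z * X$3$1 - w' * X$2$3 \<in> I k"
proof -
  obtain X :: "'a ^ 3 ^ 3" where X: "det X \<notin> I 1" "mcong k (X ** nf x u v z w) (nf x u' v' z' w' ** X)"
    using assms unfolding sim_def by blast
  show thesis
    by (rule that[OF X(1)]; use X(2) in \<open>simp add: mcong_def forall_3 nf_def matrix3_simps algebra_simps\<close>)
qed

text \<open>Modulo \<open>I j\<close> the last two columns are multiples of the second unit
  vector.\<close>

lemma det_in_I:
  fixes X :: "'a ^ 3 ^ 3"
  assumes "X$1$2 \<in> I j" "X$3$2 \<in> I j" "X$1$3 \<in> I j" "X$3$3 \<in> I j"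
  shows "det X \<in> I j"
  unfolding det_3 using assms by (intro I_add I_diff) (auto intro: I_mult I_mult_right)

text \<open>The characteristic polynomial determines only \<open>z w\<close>, so that for \<open>z = p\<^sup>m\<close> the parameter \<open>w\<close> has to
  be recovered from the intertwining equations. These give two multiples of \<open>w - w'\<close> that
  vanish, and the intertwiner is singular unless one of the two factors is a unit.\<close>

lemma reps_I_unique_w:
  assumes sim: "sim k (nf x u (p ^ m * v) (p ^ m) (p ^ m * w)) (nf x u (p ^ m * v) (p ^ m) (p ^ m * w'))"
    and "m \<le> k" "k \<le> L" "1 \<le> k"
  shows "w - w' \<in> I (k - m)"
proof (cases "m = 0")
  case True
  then show ?thesis using sim_nf_invariants(3)[OF sim] by simp
next
  case False
  then have pm: "p ^ m * c \<in> I 1" for c using I_antimono[OF power_mult_in[of m c], of 1] by simp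
  obtain X :: "'a ^ 3 ^ 3" where X: "det X \<notin> I 1"
    and E11: "X$1$2 - (p ^ m * v * X$2$1 + p ^ m * X$3$1) \<in> I k" (is "?E11 \<in> _")
    and E21: "X$2$2 - (X$1$1 + u * X$2$1) \<in> I k" (is "?E21 \<in> _")
    and E31: "X$3$2 - p ^ m * w' * X$2$1 \<in> I k" (is "?E31 \<in> _")
    and E12: "p ^ m * v * X$1$1 + u * X$1$2 + p ^ m * w * X$1$3 - (p ^ m * v * X$2$2 + p ^ m * X$3$2) \<in> I k" (is "?E12 \<in> _")
    and E32: "p ^ m * v * X$3$1 + u * X$3$2 + p ^ m * w * X$3$3 - p ^ m * w' * X$2$2 \<in> I k" (is "?E32 \<in> _")
    and E13: "p ^ m * X$1$1 - (p ^ m * v * X$2$3 + p ^ m * X$3$3) \<in> I k" (is "?E13 \<in> _")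
    and E23: "p ^ m * X$2$1 - (X$1$3 + u * X$2$3) \<in> I k" (is "?E23 \<in> _")
    and E33: "p ^ m * X$3$1 - p ^ m * w' * X$2$3 \<in> I k" (is "?E33 \<in> _")
    by (rule sim_nf_obtain[OF sim]) (rule that; assumption)
  \<comment> \<open>By \<open>E23\<close> this is \<open>X$1$3\<close> modulo
    \<open>I k\<close>.\<close>
  define y where "y = p ^ m * X$2$1 - u * X$2$3"
  \<comment> \<open>In this combination all entries of \<open>X\<close> other than
    \<open>X$3$3\<close> cancel; the next combination does the same for \<open>y\<close>.\<close>
  have "?E32 - u * ?E31 + p ^ m * w' * ?E21 - v * ?E33 + w' * ?E13 \<in> I k"
    by (intro I_add I_diff I_mult E32 E31 E21 E33 E13)
  then have 1: "p ^ m * (X$3$3 * (w - w')) \<in> I k" by (simp add: algebra_simps)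
  have "?E12 - u * ?E11 + p ^ m * v * ?E21 + p ^ m * ?E31 - u * ?E33 + p ^ m * w * ?E23 \<in> I k"
    by (intro I_add I_diff I_mult E12 E11 E21 E31 E33 E23)
  then have 2: "p ^ m * (y * (w - w')) \<in> I k" by (simp add: y_def algebra_simps)
  \<comment> \<open>Since \<open>m\<close> is positive, \<open>E11\<close> and \<open>E31\<close>
    put \<open>X$1$2\<close> and \<open>X$3$2\<close> into \<open>I 1\<close>. If \<open>y\<close>
    and \<open>X$3$3\<close> were there as well, \<open>det_in_I\<close> would make \<open>X\<close>
    singular.\<close>
  have "\<not> (X$3$3 \<in> I 1 \<and> y \<in> I 1)"
  proof
    assume *: "X$3$3 \<in> I 1 \<and> y \<in> I 1"
    note E = I_antimono[OF _ \<open>1 \<le> k\<close>]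
    have "p ^ m * v * X$2$1 + p ^ m * X$3$1 \<in> I 1" "p ^ m * w' * X$2$1 \<in> I 1"
      unfolding mult.assoc by (intro I_add pm)+
    moreover have "y - X$1$3 \<in> I 1" using E[OF E23] by (simp add: y_def algebra_simps)
    ultimately have "X$1$2 \<in> I 1" "X$3$2 \<in> I 1" "X$1$3 \<in> I 1"
      using I_shift[OF E[OF E11]] I_shift[OF E[OF E31]] I_shift[of y "X$1$3"] * by blast+
    then show False using det_in_I * X by blast
  qed
  then show ?thesis
    using I_power_cancel[OF 1 assms(2,3)] I_power_cancel[OF 2 assms(2,3)] unit_cancel by blast
qed

text \<open>Here \<open>X$3$3\<close> must be a unit: as \<open>m\<close> is positive and
  \<open>u\<close> lies in \<open>I 1\<close>, the entries \<open>X$1$2\<close>,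
  \<open>X$3$2\<close> and \<open>X$1$3\<close> lie in \<open>I 1\<close>. A single multiple of
  \<open>z - z'\<close> is therefore enough.\<close>

lemma reps_II_unique_z:
  assumes sim: "sim k (nf x u (p ^ Suc m * v) (p ^ Suc m * z) (p ^ m))
      (nf x u (p ^ Suc m * v) (p ^ Suc m * z') (p ^ m))"
    and "1 \<le> m" "m < k" "k \<le> L" "u \<in> I 1"
  shows "z - z' \<in> I (k - m - 1)"
proof -
  have pm: "p ^ m * c \<in> I 1" for c using I_antimono[OF power_mult_in[of m c], of 1] \<open>1 \<le> m\<close> by simp
  have pm': "p ^ Suc m * c \<in> I 1" for c using I_antimono[OF power_mult_in[of "Suc m" c], of 1] by simp
  obtain X :: "'a ^ 3 ^ 3" where X: "det X \<notin> I 1"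
    and E11: "X$1$2 - (p ^ Suc m * v * X$2$1 + p ^ Suc m * z' * X$3$1) \<in> I k"
    and E21: "X$2$2 - (X$1$1 + u * X$2$1) \<in> I k" (is "?E21 \<in> _")
    and E31: "X$3$2 - p ^ m * X$2$1 \<in> I k" (is "?E31 \<in> _")
    and E32: "p ^ Suc m * v * X$3$1 + u * X$3$2 + p ^ m * X$3$3 - p ^ m * X$2$2 \<in> I k" (is "?E32 \<in> _")
    and E13: "p ^ Suc m * z * X$1$1 - (p ^ Suc m * v * X$2$3 + p ^ Suc m * z' * X$3$3) \<in> I k" (is "?E13 \<in> _")
    and E23: "p ^ Suc m * z * X$2$1 - (X$1$3 + u * X$2$3) \<in> I k"
    and E33: "p ^ Suc m * z * X$3$1 - p ^ m * X$2$3 \<in> I k" (is "?E33 \<in> _")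
    by (rule sim_nf_obtain[OF sim]) (rule that; assumption)
  have "p * z * (?E32 - u * ?E31 + p ^ m * ?E21) - p * v * ?E33 + ?E13 \<in> I k"
    by (intro I_add I_diff I_mult E32 E31 E21 E33 E13)
  then have 1: "p ^ Suc m * (X$3$3 * (z - z')) \<in> I k" by (simp add: algebra_simps)
  have "X$3$3 \<notin> I 1"
  proof
    assume *: "X$3$3 \<in> I 1"
    have E: "c \<in> I k \<Longrightarrow> c \<in> I 1" for c using I_antimono[of c k 1] assms by simp
    have "p ^ Suc m * v * X$2$1 + p ^ Suc m * z' * X$3$1 \<in> I 1" "p ^ m * X$2$1 \<in> I 1"
      "p ^ Suc m * z * X$2$1 - u * X$2$3 \<in> I 1"
      unfolding mult.assoc using assms by (intro I_add I_diff pm pm' I_mult_right; simp)+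
    moreover have "p ^ Suc m * z * X$2$1 - u * X$2$3 - X$1$3 \<in> I 1"
      using E[OF E23] by (simp add: algebra_simps)
    ultimately have "X$1$2 \<in> I 1" "X$3$2 \<in> I 1" "X$1$3 \<in> I 1"
      using I_shift[OF E[OF E11]] I_shift[OF E[OF E31]] I_shift[of _ "X$1$3"] by blast+
    then show False using det_in_I * X by blast
  qed
  moreover have "X$3$3 * (z - z') \<in> I (k - m - 1)"
    using I_power_cancel[OF 1 Suc_leI[OF \<open>m < k\<close>] \<open>k \<le> L\<close>] by simp
  ultimately show ?thesis using unit_cancel by blast
qed

text \<open>The invariants force \<open>v' \<in> I (Suc m)\<close> and \<open>u' \<in> I 1\<close>.
  Then \<open>E13\<close> shows \<open>p ^ m * X$3$3 \<in> I (Suc m)\<close>, so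
  \<open>X$3$3\<close> is not a unit, and the other equations make \<open>X\<close>
  singular.\<close>

lemma reps_II_I_not_sim:
  assumes sim: "sim k (nf x u (p ^ Suc m * v) (p ^ Suc m * z) (p ^ m))
      (nf x u' v' (p ^ m) w')"
    and "1 \<le> m" "m < k" "k \<le> L" "u \<in> I 1" "w' \<in> I 1"
  shows False
proof -
  have E: "c \<in> I k \<Longrightarrow> c \<in> I 1" for c using I_antimono[of c k 1] assms by simp
  have E': "c \<in> I k \<Longrightarrow> c \<in> I (Suc m)" for c using I_antimono[of c k "Suc m"] assms by simp
  have pm: "p ^ m * c \<in> I 1" for c using I_antimono[OF power_mult_in[of m c], of 1] \<open>1 \<le> m\<close> by simp
  have u': "u' \<in> I 1" using sim_nf_invariants(1)[OF sim] I_shift E assms by blast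
  have v': "v' \<in> I (Suc m)"
    using I_shift[OF E'[OF sim_nf_invariants(2)[OF sim]]] power_mult_in by blast
  then have v'1: "v' \<in> I 1" using I_antimono by fastforce
  obtain X :: "'a ^ 3 ^ 3" where X: "det X \<notin> I 1"
    and E11: "X$1$2 - (v' * X$2$1 + p ^ m * X$3$1) \<in> I k"
    and E31: "X$3$2 - w' * X$2$1 \<in> I k"
    and E13: "p ^ Suc m * z * X$1$1 - (v' * X$2$3 + p ^ m * X$3$3) \<in> I k" (is "?E13 \<in> _")
    and E23: "p ^ Suc m * z * X$2$1 - (X$1$3 + u' * X$2$3) \<in> I k" (is "?E23 \<in> _")
    by (rule sim_nf_obtain[OF sim]) (rule that; assumption)
  have "p ^ Suc m * (z * X$1$1) - v' * X$2$3 - ?E13 \<in> I (Suc m)"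
    by (intro I_diff I_mult_right v' power_mult_in E'[OF E13])
  then have "p ^ m * X$3$3 \<in> I (m + 1)" by (simp add: algebra_simps)
  then have 33: "X$3$3 \<in> I 1" using I_cancel assms by (metis Suc_eq_plus1 Suc_leI order_trans)
  have "p ^ m * (p * z * X$2$1) - u' * X$2$3 - ?E23 \<in> I 1"
    by (rule I_diff[OF I_diff[OF pm I_mult_right[OF u']] E[OF E23]])
  then have 13: "X$1$3 \<in> I 1" by (simp add: algebra_simps)
  have "v' * X$2$1 + p ^ m * X$3$1 \<in> I 1" "w' * X$2$1 \<in> I 1"
    by (intro I_add pm I_mult_right v'1 assms)+
  then have "X$1$2 \<in> I 1" "X$3$2 \<in> I 1"
    using I_shift[OF E[OF E11]] I_shift[OF E[OF E31]] by blast+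
  then show False using det_in_I 33 13 X by blast
qed

text \<open>In both families one of \<open>z\<close> and \<open>w\<close> is exactly
  \<open>p ^ m\<close>, so \<open>sim_nf_depth\<close>, applied in both directions, compares the
  exponents. Then \<open>x\<close> and \<open>x'\<close> are representatives of the same residue
  modulo \<open>I m\<close>.\<close>

lemma sim_nf_same_shape:
  assumes sim: "sim k (nf x u v z w) (nf x' u' v' z' w')" and "m \<le> k" "m' \<le> k" "k \<le> L"
    and "x \<in> S m" "x' \<in> S m'" "v \<in> I m" "z \<in> I m" "w \<in> I m" "v' \<in> I m'" "z' \<in> I m'" "w' \<in> I m'"
    and "z = p ^ m \<or> w = p ^ m" "z' = p ^ m' \<or> w' = p ^ m'"
  shows "m = m' \<and> x = x'"
proof -
  have "p ^ m' \<in> I m" using sim_nf_depth[OF sim, of m] assms by metis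
  moreover have "p ^ m \<in> I m'" using sim_nf_depth[OF sim_sym[OF sim], of m'] assms by metis
  ultimately have m: "m = m'" using power_in_I_iff assms by (meson le_antisym order_trans)
  have "x - x' \<in> I m" using sim_nf_depth(4)[OF sim, of m] assms by blast
  then show ?thesis using S_eq m assms by (meson order_trans)
qed


lemma power_in_I: "j \<le> i \<Longrightarrow> p ^ i * c \<in> I j"
  using I_antimono power_mult_in by blast

lemma p_power_in_I1: "1 \<le> m \<Longrightarrow> p ^ m * c \<in> I 1" "1 \<le> m \<Longrightarrow> p ^ m \<in> I 1"
  using power_in_I[of 1 m] power_in_I[of 1 m 1] by simp_all

text \<open>The parameters are recovered in the order \<open>m\<close>, \<open>x\<close>,
  \<open>u\<close>, \<open>v\<close>, \<open>w\<close>, since the comparison of each later one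
  presupposes agreement of earlier ones.\<close>

lemma nf_I_unique:
  assumes "a \<in> params_I k" "b \<in> params_I k" "sim k (nf_I a) (nf_I b)" "1 \<le> k" "k \<le> L"
  shows "a = b"
proof -
  obtain m x u v w m' x' u' v' w' where a: "a = (m, x, u, v, w)" and b: "b = (m', x', u', v', w')"
    using prod_cases5 by metis
  have m: "m \<le> k" "m' \<le> k" and x: "x \<in> S m" "x' \<in> S m'" and u: "u \<in> S k" "u' \<in> S k"
    and vw: "v \<in> S (k - m)" "w \<in> S (k - m)" "v' \<in> S (k - m')" "w' \<in> S (k - m')"
    using assms(1,2) by (auto simp: params_I_def a b)
  have sim: "sim k (nf x u (p ^ m * v) (p ^ m) (p ^ m * w)) (nf x' u' (p ^ m' * v') (p ^ m') (p ^ m' * w'))"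
    using assms(3) by (simp add: nf_I_def a b)
  have mx: "m' = m" "x' = x"
    using sim_nf_same_shape[OF sim m \<open>k \<le> L\<close> x] power_mult_in power_in_I[of m m 1] power_in_I[of m' m' 1]
    by auto
  have uu: "u' = u" using S_eq[OF u] sim_nf_invariants(1)[OF sim[unfolded mx]] \<open>k \<le> L\<close> by simp
  have "p ^ m * (v - v') \<in> I k"
    using sim_nf_invariants(2)[OF sim[unfolded mx]] by (simp add: right_diff_distrib)
  then have "v - v' \<in> I (k - m)" using I_power_cancel m \<open>k \<le> L\<close> by blast
  then have vv: "v' = v" using S_eq vw \<open>k \<le> L\<close> unfolding mx by (metis diff_le_self order_trans)
  have "w - w' \<in> I (k - m)"
    using reps_I_unique_w sim m assms(4,5) unfolding mx uu vv by blast
  then have "w' = w" using S_eq vw \<open>k \<le> L\<close> unfolding mx by (metis diff_le_self order_trans)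
  then show ?thesis unfolding a b mx uu vv by simp
qed

lemma nf_II_unique:
  assumes "a \<in> params_II k" "b \<in> params_II k" "sim k (nf_II a) (nf_II b)" "k \<le> L"
  shows "a = b"
proof -
  obtain m x u v z m' x' u' v' z' where a: "a = (m, x, u, v, z)" and b: "b = (m', x', u', v', z')"
    using prod_cases5 by metis
  have m: "1 \<le> m" "m < k" "1 \<le> m'" "m' < k" and x: "x \<in> S m" "x' \<in> S m'"
    and u: "u \<in> S (k - 1)" "u' \<in> S (k - 1)"
    and vz: "v \<in> S (k - m - 1)" "z \<in> S (k - m - 1)" "v' \<in> S (k - m' - 1)" "z' \<in> S (k - m' - 1)"
    using assms(1,2) by (auto simp: params_II_def a b)
  have sim: "sim k (nf x (p * u) (p ^ Suc m * v) (p ^ Suc m * z) (p ^ m))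
      (nf x' (p * u') (p ^ Suc m' * v') (p ^ Suc m' * z') (p ^ m'))"
    using assms(3) by (simp add: nf_II_def a b)
  have mx: "m' = m" "x' = x"
    using sim_nf_same_shape[OF sim _ _ \<open>k \<le> L\<close> x] m
      power_in_I[of m "Suc m"] power_in_I[of m' "Suc m'"] power_in_I[of m m 1] power_in_I[of m' m' 1]
    by auto
  have "p ^ 1 * (u - u') \<in> I k"
    using sim_nf_invariants(1)[OF sim[unfolded mx]] by (simp add: right_diff_distrib)
  then have "u - u' \<in> I (k - 1)" using I_power_cancel[of 1 _ k] m \<open>k \<le> L\<close> by simp
  then have uu: "u' = u" using S_eq[OF u] \<open>k \<le> L\<close> by simp
  have "p ^ Suc m * (v - v') \<in> I k"
    using sim_nf_invariants(2)[OF sim[unfolded mx]] by (simp add: right_diff_distrib)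
  then have "v - v' \<in> I (k - Suc m)"
    using I_power_cancel[OF _ Suc_leI[OF \<open>m < k\<close>]] \<open>k \<le> L\<close> by blast
  then have vv: "v' = v" using S_eq[of v "k - m - 1" v'] vz \<open>k \<le> L\<close> unfolding mx by simp
  have "z - z' \<in> I (k - m - 1)"
    using reps_II_unique_z[OF _ m(1,2) \<open>k \<le> L\<close>] sim unfolding mx uu vv by simp
  then have "z' = z" using S_eq[of z "k - m - 1" z'] vz \<open>k \<le> L\<close> unfolding mx by simp
  then show ?thesis unfolding a b mx uu vv by simp
qed

lemma nf_II_nf_I_not_sim:
  assumes "a \<in> params_II k" "b \<in> params_I k" "sim k (nf_II a) (nf_I b)" "k \<le> L"
  shows False
proof -
  obtain m x u v z m' x' u' v' w' where a: "a = (m, x, u, v, z)" and b: "b = (m', x', u', v', w')"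
    using prod_cases5 by metis
  have m: "1 \<le> m" "m < k" "m' \<le> k" and x: "x \<in> S m" "x' \<in> S m'"
    using assms(1,2) by (auto simp: params_I_def params_II_def a b)
  have sim: "sim k (nf x (p * u) (p ^ Suc m * v) (p ^ Suc m * z) (p ^ m))
      (nf x' u' (p ^ m' * v') (p ^ m') (p ^ m' * w'))"
    using assms(3) by (simp add: nf_I_def nf_II_def a b)
  have mx: "m' = m" "x' = x"
    using sim_nf_same_shape[OF sim _ _ \<open>k \<le> L\<close> x] m power_mult_in
      power_in_I[of m "Suc m"] power_in_I[of m m 1] power_in_I[of m' m' 1]
    by auto
  show False
    by (rule reps_II_I_not_sim[OF sim[unfolded mx] m(1,2) \<open>k \<le> L\<close>])
       (use p_power_in_I1 m in simp_all)
qed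

lemma reps_unique:
  assumes "A \<in> reps_I k \<union> reps_II k" "B \<in> reps_I k \<union> reps_II k" "sim k A B" "1 \<le> k" "k \<le> L"
  shows "A = B"
  using assms(1,2) unfolding reps_I_def reps_II_def
proof (elim UnE imageE)
  fix a b
  assume "A = nf_I a" "a \<in> params_I k" "B = nf_I b" "b \<in> params_I k"
  then show ?thesis using nf_I_unique[of a k b] assms by simp
next
  fix a b
  assume "A = nf_II a" "a \<in> params_II k" "B = nf_II b" "b \<in> params_II k"
  then show ?thesis using nf_II_unique[of a k b] assms by simp
next
  fix a b
  assume "A = nf_I a" "a \<in> params_I k" "B = nf_II b" "b \<in> params_II k"
  then show ?thesis using nf_II_nf_I_not_sim[of b k a] sim_sym assms by simp
next
  fix a b
  assume "A = nf_II a" "a \<in> params_II k" "B = nf_I b" "b \<in> params_I k"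
  then show ?thesis using nf_II_nf_I_not_sim[of a k b] assms by simp
qed

lemma nf_not_scalar1: "\<not> scalar1 (nf x u v z w)"
  unfolding scalar1_def mcong_def forall_3 nf_def by simp

lemma reps_not_scalar1: "A \<in> reps_I k \<union> reps_II k \<Longrightarrow> \<not> scalar1 A"
  using nf_not_scalar1 by (auto simp: reps_I_def reps_II_def nf_I_def nf_II_def)

section \<open>Counting similarity classes\<close>

definition lift_mat :: "'a \<Rightarrow> 'a ^ 3 ^ 3 \<Rightarrow> 'a ^ 3 ^ 3" where
  "lift_mat d A = mat d + mat p ** A"

lemma mcong_lift_mat: "mcong 1 (lift_mat d A) (mat d)"
  by (simp add: mcong_def lift_mat_def)

text \<open>The scalar \<open>d\<close> commutes with \<open>X\<close>, so the defect of
  intertwining for the lifts is \<open>p\<close> times that for \<open>A\<close> and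
  \<open>B\<close>. Cancelling \<open>p\<close> lowers the level by one, and the condition on
  \<open>det X\<close> is the same at every level.\<close>

lemma sim_lift_mat_iff:
  assumes "Suc k \<le> L"
  shows "sim (Suc k) (lift_mat d A) (lift_mat d B) \<longleftrightarrow> sim k A B"
proof -
  have "(X ** lift_mat d A) $ i $ j - (lift_mat d B ** X) $ i $ j
      = p ^ 1 * ((X ** A) $ i $ j - (B ** X) $ i $ j)" for X i j
  proof -
    have "lift_mat d B ** X = mat d ** X + mat p ** (B ** X)"
      unfolding lift_mat_def by (simp add: matrix3_simps algebra_simps)
    then show ?thesis
      unfolding lift_mat_def matrix_add_ldistrib
      by (simp add: mat_commute matrix_mult_mat_left right_diff_distrib)
  qed
  then show ?thesis
    unfolding sim_def mcong_def using I_power_mult_iff[of 1 k] assms by simp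
qed

lemma sim_lift_mat_eq:
  assumes "sim (Suc k) (lift_mat d A) (lift_mat e B)" "d \<in> T" "e \<in> T"
  shows "d = e"
proof -
  have "mcong 1 (lift_mat e B) (mat d)"
    using sim_mcong_mat[OF assms(1)] mcong_lift_mat by simp
  then have "mcong 1 (mat e) (mat d)"
    using mcong_lift_mat mcong_sym mcong_trans by blast
  then have "e - d \<in> I 1" unfolding mcong_def using mat_nth3(1) by metis
  then show ?thesis using T_eq assms(2,3) by blast
qed

lemma scalar1_lift_mat:
  assumes "scalar1 M" shows "\<exists>d\<in>T. \<exists>A. mcong k M (lift_mat d A)"
proof -
  obtain c where c: "mcong 1 M (mat c)" using assms scalar1_def by blast
  obtain d where d: "d \<in> T" "c - d \<in> I 1" using T_ex by blast
  have "mcong 1 (mat c) (mat d)" using d by (simp add: mcong_def forall_3)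
  with c have "mcong 1 M (mat d)" by (rule mcong_trans)
  then have "\<exists>a. (M $ i $ j - mat d $ i $ j) - p ^ 1 * a \<in> I k" for i j
    unfolding mcong_def using I_obtain by meson
  then obtain a where a: "\<And>i j. (M $ i $ j - mat d $ i $ j) - p ^ 1 * a i j \<in> I k" by metis
  have "mcong k M (lift_mat d (\<chi> i j. a i j))"
    using a by (simp add: mcong_def lift_mat_def algebra_simps)
  then show ?thesis using d by blast
qed

text \<open>The recursion starts at \<open>k = 0\<close>, where all matrices are congruent and form
  one class; the residue field is then the first instance of the recursive step.\<close>

primrec class_reps :: "nat \<Rightarrow> ('a ^ 3 ^ 3) set" where
  "class_reps 0 = {0}"
| "class_reps (Suc k) = (\<lambda>(d, A). lift_mat d A) ` (T \<times> class_reps k)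
     \<union> (reps_I (Suc k) \<union> reps_II (Suc k))"


lemma class_reps_ex: "k \<le> L \<Longrightarrow> \<exists>A\<in>class_reps k. sim k A M"
proof (induction k arbitrary: M)
  case 0
  show ?case by (auto simp: mcong_def intro: mcong_sim)
next
  case (Suc k)
  show ?case
  proof (cases "scalar1 M")
    case True
    then obtain d A where d: "d \<in> T" "mcong (Suc k) M (lift_mat d A)" using scalar1_lift_mat by blast
    obtain B where B: "B \<in> class_reps k" "sim k B A" using Suc by (meson Suc_leD)
    have "sim (Suc k) (lift_mat d B) M"
      using sim_lift_mat_iff[OF Suc.prems] B(2) mcong_sim[OF mcong_sym[OF d(2)]] sim_trans by blast
    then show ?thesis using d(1) B(1) by force
  next
    case False
    then obtain x u v z w where "sim (Suc k) (nf x u v z w) M" using nonscalar_sim_nf by blast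
    moreover obtain A where "A \<in> reps_I (Suc k) \<union> reps_II (Suc k)" "sim (Suc k) A (nf x u v z w)"
      using nf_sim_rep by blast
    ultimately have "A \<in> class_reps (Suc k)" "sim (Suc k) A M" using sim_trans by auto
    then show ?thesis by blast
  qed
qed

lemma class_reps_unique:
  "k \<le> L \<Longrightarrow> A \<in> class_reps k \<Longrightarrow> B \<in> class_reps k \<Longrightarrow> sim k A B \<Longrightarrow> A = B"
proof (induction k arbitrary: A B)
  case (Suc k)
  have scalar: "scalar1 (lift_mat d C)" for d C unfolding scalar1_def using mcong_lift_mat by blast
  have scalar_iff: "scalar1 A \<longleftrightarrow> scalar1 B" 
    using Suc.prems(4) sim_mcong_mat sim_sym unfolding scalar1_def by (metis Suc_eq_plus1 le_add2)
  show ?case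
  proof (cases "scalar1 A")
    case True
    then obtain d C e D where *: "A = lift_mat d C" "d \<in> T" "C \<in> class_reps k"
      "B = lift_mat e D" "e \<in> T" "D \<in> class_reps k"
      using Suc.prems(2,3) scalar_iff reps_not_scalar1[of A "Suc k"] reps_not_scalar1[of B "Suc k"] by auto
    then have "d = e" using sim_lift_mat_eq Suc.prems(4) by blast
    then show ?thesis using * Suc sim_lift_mat_iff[OF Suc.prems(1)] by (metis Suc_leD)
  next
    case False
    then show ?thesis
      using Suc.prems scalar_iff scalar reps_unique[of A "Suc k" B] by auto
  qed
qed simp

section \<open>Cardinalities of the families and of their invertible members\<close>

lemma finite_params: "finite (params_I k)" "finite (params_II k)"
  by (auto simp: params_I_def params_II_def)

lemma finite_class_reps: "finite (class_reps k)"
  by (induction k) (auto simp: finite_T finite_params reps_I_def reps_II_def)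

lemma inj_on_nf_I: "1 \<le> k \<Longrightarrow> k \<le> L \<Longrightarrow> inj_on nf_I (params_I k)"
  using nf_I_unique sim_refl by (intro inj_onI) metis

lemma inj_on_nf_II: "k \<le> L \<Longrightarrow> inj_on nf_II (params_II k)"
  using nf_II_unique sim_refl by (intro inj_onI) metis

lemma inj_on_lift_mat:
  assumes "Suc k \<le> L" shows "inj_on (\<lambda>(d, A). lift_mat d A) (T \<times> class_reps k)"
proof (rule inj_onI, clarify)
  fix d A e B assume *: "d \<in> T" "e \<in> T" "A \<in> class_reps k" "B \<in> class_reps k"
    "lift_mat d A = lift_mat e B"
  then have "sim (Suc k) (lift_mat d A) (lift_mat e B)" by simp
  then show "d = e \<and> A = B"
    using * assms sim_lift_mat_eq sim_lift_mat_iff class_reps_unique by (metis Suc_leD)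
qed

text \<open>The predicate \<open>P\<close> allows one decomposition to serve both counts: it is
  \<open>True\<close> for all matrices and a unit determinant for the general linear group. The
  lifts are separated from the rest by \<open>scalar1\<close>, and the two families from each other
  by non-similarity.\<close>

lemma card_class_reps_filter:
  assumes "Suc k \<le> L"
  shows "card {M \<in> class_reps (Suc k). P M} =
    card {(d, A). (d, A) \<in> T \<times> class_reps k \<and> P (lift_mat d A)}
    + card {a \<in> params_I (Suc k). P (nf_I a)} + card {a \<in> params_II (Suc k). P (nf_II a)}"
proof -
  define X where "X = {(d, A). (d, A) \<in> T \<times> class_reps k \<and> P (lift_mat d A)}"
  define Y where "Y = {a \<in> params_I (Suc k). P (nf_I a)}"
  define Z where "Z = {a \<in> params_II (Suc k). P (nf_II a)}"
  have sub: "X \<subseteq> T \<times> class_reps k" "Y \<subseteq> params_I (Suc k)" "Z \<subseteq> params_II (Suc k)"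
    by (auto simp: X_def Y_def Z_def)
  have fin: "finite X" "finite Y" "finite Z"
    using sub finite_subset finite_params finite_T finite_class_reps by (meson finite_SigmaI)+
  have scalar: "scalar1 (lift_mat d C)" for d C unfolding scalar1_def using mcong_lift_mat by blast
  have "scalar1 M" if "M \<in> (\<lambda>(d, A). lift_mat d A) ` X" for M
    using that scalar by auto
  moreover have "\<not> scalar1 M" if "M \<in> nf_I ` Y \<union> nf_II ` Z" for M
    using that sub reps_not_scalar1[of M "Suc k"] unfolding reps_I_def reps_II_def by blast
  moreover have "nf_II b \<noteq> nf_I a" if "a \<in> Y" "b \<in> Z" for a b
  proof -
    have "a \<in> params_I (Suc k)" "b \<in> params_II (Suc k)" using that sub by blast+
    then show ?thesis using nf_II_nf_I_not_sim[of b "Suc k" a] assms sim_refl by metis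
  qed
  then have "nf_I ` Y \<inter> nf_II ` Z = {}" by force
  ultimately have 1: "((\<lambda>(d, A). lift_mat d A) ` X \<union> nf_I ` Y) \<inter> nf_II ` Z = {}"
    "(\<lambda>(d, A). lift_mat d A) ` X \<inter> nf_I ` Y = {}"
    by (blast, blast)
  have "{M \<in> class_reps (Suc k). P M} = ((\<lambda>(d, A). lift_mat d A) ` X \<union> nf_I ` Y) \<union> nf_II ` Z"
    by (auto simp: X_def Y_def Z_def reps_I_def reps_II_def)
  also have "card \<dots> = card ((\<lambda>(d, A). lift_mat d A) ` X) + card (nf_I ` Y) + card (nf_II ` Z)"
    using 1 fin by (subst card_Un_disjoint; simp add: card_Un_disjoint)
  also have "card ((\<lambda>(d, A). lift_mat d A) ` X) = card X"
    by (rule card_image[OF inj_on_subset[OF inj_on_lift_mat[OF assms] sub(1)]])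
  also have "card (nf_I ` Y) = card Y"
    by (rule card_image[OF inj_on_subset[OF inj_on_nf_I[OF _ assms] sub(2)]]) simp
  also have "card (nf_II ` Z) = card Z"
    by (rule card_image[OF inj_on_subset[OF inj_on_nf_II[OF assms] sub(3)]])
  finally show ?thesis unfolding X_def Y_def Z_def .
qed

lemma card_params_I: "k \<le> L \<Longrightarrow> card (params_I k) = (\<Sum>m\<le>k. q ^ m * (q ^ k * (q ^ (k - m) * q ^ (k - m))))"
  unfolding params_I_def by (subst card_SigmaI) (auto simp: card_cartesian_product card_S)

lemma card_params_II:
  "k \<le> L \<Longrightarrow> card (params_II k) =
    (\<Sum>m\<in>{1..<k}. q ^ m * (q ^ (k - 1) * (q ^ (k - m - 1) * q ^ (k - m - 1))))"
  unfolding params_II_def by (subst card_SigmaI) (auto simp: card_cartesian_product card_S)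

lemma card_class_reps_Suc:
  "Suc k \<le> L \<Longrightarrow> card (class_reps (Suc k)) =
    q * card (class_reps k) + card (params_I (Suc k)) + card (params_II (Suc k))"
proof -
  assume "Suc k \<le> L"
  moreover have "{(d, A). (d, A) \<in> T \<times> class_reps k \<and> True} = T \<times> class_reps k" by auto
  ultimately show ?thesis
    using card_class_reps_filter[of k "\<lambda>_. True"]
    by (simp add: card_cartesian_product del: class_reps.simps)
qed

text \<open>For \<open>m = 0\<close> the set \<open>S 0\<close> forces \<open>x = 0\<close>, and the
  determinant is \<open>w\<close>. For \<open>m > 0\<close> it is congruent to
  \<open>x * x * (x + u)\<close> modulo \<open>I 1\<close>.\<close>

lemma det_unit_nf_I:
  assumes "(m, x, u, v, w) \<in> params_I k"
  shows "det (nf_I (m, x, u, v, w)) \<notin> I 1 \<longleftrightarrow> (if m = 0 then w \<notin> I 1 else x \<notin> I 1 \<and> x + u \<notin> I 1)"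
proof (cases "m = 0")
  case True
  then show ?thesis using assms by (simp add: params_I_def nf_I_def det_nf)
next
  case False
  then have "det (nf_I (m, x, u, v, w)) - x * (x * (x + u)) \<in> I 1"
    by (intro I_comb2[OF p_power_in_I1(2) p_power_in_I1(2), of m m _ "- v * x" "p ^ m * w"])
       (simp_all add: nf_I_def det_nf power2_eq_square power3_eq_cube algebra_simps)
  from I_shift[OF this] False show ?thesis using I_prime_iff by auto
qed

lemma det_unit_nf_II:
  assumes "(m, x, u, v, z) \<in> params_II k"
  shows "det (nf_II (m, x, u, v, z)) \<notin> I 1 \<longleftrightarrow> x \<notin> I 1"
proof -
  have "p \<in> I 1" using p_mult_in[of 1] by simp
  then have "det (nf_II (m, x, u, v, z)) - x * (x * x) \<in> I 1"
    by (rule I_comb1[of p 1 _ "u * x ^ 2 - p ^ m * v * x + p ^ m * z * p ^ m"])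
       (simp_all add: nf_II_def det_nf power2_eq_square power3_eq_cube algebra_simps)
  from I_shift[OF this] show ?thesis using I_prime_iff by auto
qed

lemma card_units_params_I:
  assumes "Suc k \<le> L"
  shows "card {a \<in> params_I (Suc k). det (nf_I a) \<notin> I 1} =
    q ^ Suc k * (q ^ Suc k * ((q - 1) * q ^ k)) +
    (\<Sum>n\<le>k. (q - 1) * q ^ n * ((q - 1) * q ^ k * (q ^ (k - n) * q ^ (k - n))))"
proof -
  \<comment> \<open>The slices of fixed \<open>m\<close>. The summand \<open>0 +\<close> gives the
    conditions the shape used in \<open>card_units_S\<close>, and \<open>x + u\<close> is counted
    with shift \<open>x\<close>.\<close>
  define U where "U m = (if m = 0 then S m \<times> S (Suc k) \<times> S (Suc k) \<times> {w \<in> S (Suc k). 0 + w \<notin> I 1}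
    else (SIGMA x:{x \<in> S m. 0 + x \<notin> I 1}. {u \<in> S (Suc k). x + u \<notin> I 1} \<times> S (Suc k - m) \<times> S (Suc k - m)))"
    for m
  have "{a \<in> params_I (Suc k). det (nf_I a) \<notin> I 1} = (SIGMA m:{..Suc k}. U m)"
  proof (rule Set.set_eqI)
    fix a :: "nat \<times> 'a \<times> 'a \<times> 'a \<times> 'a"
    obtain m x u v w where a: "a = (m, x, u, v, w)" using prod_cases5 by metis
    show "a \<in> {a \<in> params_I (Suc k). det (nf_I a) \<notin> I 1} \<longleftrightarrow> a \<in> (SIGMA m:{..Suc k}. U m)"
      using det_unit_nf_I[of m x u v w "Suc k"] unfolding a U_def
      by (auto simp: params_I_def simp del: S.simps(2))
  qed
  then have "card {a \<in> params_I (Suc k). det (nf_I a) \<notin> I 1} = (\<Sum>m\<le>Suc k. card (U m))"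
    by (simp only:) (rule card_SigmaI; simp add: U_def del: S.simps)
  also have "\<dots> = card (U 0) + (\<Sum>n\<le>k. card (U (Suc n)))"
    by (rule sum.atMost_Suc_shift)
  also have "card (U 0) = q ^ Suc k * (q ^ Suc k * ((q - 1) * q ^ k))"
    using assms card_units_S[OF assms, of 0]
    by (simp add: U_def card_cartesian_product card_S del: S.simps(2) power_Suc)
  also have "card (U (Suc n)) = (q - 1) * q ^ n * ((q - 1) * q ^ k * (q ^ (k - n) * q ^ (k - n)))"
    if "n \<le> k" for n
    using assms that card_units_S[OF assms] card_units_S[of n 0]
    by (simp add: U_def card_cartesian_product card_S del: S.simps(2))
  then have "(\<Sum>n\<le>k. card (U (Suc n))) =
      (\<Sum>n\<le>k. (q - 1) * q ^ n * ((q - 1) * q ^ k * (q ^ (k - n) * q ^ (k - n))))"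
    by (intro sum.cong) simp_all
  finally show ?thesis .
qed

lemma card_units_params_II:
  assumes "Suc k \<le> L"
  shows "card {a \<in> params_II (Suc k). det (nf_II a) \<notin> I 1} =
    (\<Sum>n<k. (q - 1) * q ^ n * (q ^ k * (q ^ (k - Suc n) * q ^ (k - Suc n))))"
proof -
  define U where "U m = {x \<in> S m. 0 + x \<notin> I 1} \<times> S k \<times> S (k - m) \<times> S (k - m)" for m
  have "{a \<in> params_II (Suc k). det (nf_II a) \<notin> I 1} = (SIGMA m:{Suc 0..<Suc k}. U m)"
  proof (rule Set.set_eqI)
    fix a :: "nat \<times> 'a \<times> 'a \<times> 'a \<times> 'a"
    obtain m x u v z where a: "a = (m, x, u, v, z)" using prod_cases5 by metis
    show "a \<in> {a \<in> params_II (Suc k). det (nf_II a) \<notin> I 1} \<longleftrightarrow> a \<in> (SIGMA m:{Suc 0..<Suc k}. U m)"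
      using det_unit_nf_II[of m x u v z "Suc k"] unfolding a U_def
      by (auto simp: params_II_def simp del: S.simps(2))
  qed
  then have "card {a \<in> params_II (Suc k). det (nf_II a) \<notin> I 1} = (\<Sum>m\<in>{Suc 0..<Suc k}. card (U m))"
    by (simp only:) (rule card_SigmaI; simp add: U_def del: S.simps)
  also have "\<dots> = (\<Sum>n<k. card (U (Suc n)))"
    unfolding sum.shift_bounds_Suc_ivl by (simp add: atLeast0LessThan)
  also have "\<dots> = (\<Sum>n<k. (q - 1) * q ^ n * (q ^ k * (q ^ (k - Suc n) * q ^ (k - Suc n))))"
  proof (rule sum.cong[OF refl])
    fix n assume "n \<in> {..<k}"
    then show "card (U (Suc n)) = (q - 1) * q ^ n * (q ^ k * (q ^ (k - Suc n) * q ^ (k - Suc n)))"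
      using assms card_units_S[of n 0]
      by (simp add: U_def card_cartesian_product card_S del: S.simps(2))
  qed
  finally show ?thesis .
qed

lemma card_unit_class_reps_Suc:
  assumes "Suc k \<le> L"
  shows "card {M \<in> class_reps (Suc k). det M \<notin> I 1} =
    (q - 1) * card (class_reps k) + card {a \<in> params_I (Suc k). det (nf_I a) \<notin> I 1}
    + card {a \<in> params_II (Suc k). det (nf_II a) \<notin> I 1}"
proof -
  have "det (lift_mat d A) \<notin> I 1 \<longleftrightarrow> 0 + d \<notin> I 1" for d A
  proof -
    have "det (lift_mat d A) - d * (d * d) \<in> I 1"
      using mcong_det[OF mcong_lift_mat[of d A]] by (simp add: det_3 mult.assoc)
    from I_shift[OF this] show ?thesis using I_prime_iff by auto
  qed
  then have "{(d, A). (d, A) \<in> T \<times> class_reps k \<and> det (lift_mat d A) \<notin> I 1}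
      = {d \<in> T. 0 + d \<notin> I 1} \<times> class_reps k" by auto
  then show ?thesis
    unfolding card_class_reps_filter[OF assms] using card_units_T[of 0]
    by (simp add: card_cartesian_product)
qed

end

section \<open>Closed forms over the real numbers\<close>

definition geom :: "real \<Rightarrow> nat \<Rightarrow> real" where
  "geom Q k = (\<Sum>m\<le>k. Q ^ m * (Q ^ k * (Q ^ (k - m) * Q ^ (k - m))))"

text \<open>The summands of \<open>geom Q k\<close> are \<open>Q ^ (3 * k - m)\<close>, a geometric
  progression; at \<open>Q = q\<close> they count the first family by depth.\<close>

lemma geom_closed: "(Q - 1) * geom Q k = Q * (Q ^ k) ^ 3 - (Q ^ k) ^ 2"
proof (induction k)
  case (Suc k)
  have "geom Q (Suc k) = Q ^ 3 * geom Q k + (Q ^ Suc k) ^ 2"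
    unfolding geom_def sum.atMost_Suc sum_distrib_left
    by (auto intro!: sum.cong simp: Suc_diff_le power2_eq_square power3_eq_cube)
  then have "(Q - 1) * geom Q (Suc k) = Q ^ 3 * ((Q - 1) * geom Q k) + (Q - 1) * (Q ^ Suc k) ^ 2"
    by (simp add: algebra_simps)
  then show ?case unfolding Suc by (simp add: power2_eq_square power3_eq_cube algebra_simps)
qed (simp add: geom_def)

text \<open>Dropping the term \<open>m = 0\<close> from \<open>geom Q k\<close> leaves the count of
  the second family at level \<open>Suc k\<close>.\<close>

lemma geom_tail:
  "(\<Sum>n<k. Q * Q ^ n * (Q ^ k * (Q ^ (k - Suc n) * Q ^ (k - Suc n)))) = geom Q k - (Q ^ k) ^ 3"
proof -
  have "geom Q k = (\<Sum>m<Suc k. Q ^ m * (Q ^ k * (Q ^ (k - m) * Q ^ (k - m))))"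
    unfolding geom_def by (simp add: lessThan_Suc_atMost)
  also have "\<dots> = (Q ^ k) ^ 3 + (\<Sum>n<k. Q * Q ^ n * (Q ^ k * (Q ^ (k - Suc n) * Q ^ (k - Suc n))))"
    unfolding sum.lessThan_Suc_shift by (simp add: power3_eq_cube)
  finally show ?thesis by simp
qed

context truncated_principal_local
begin

lemma real_card_class_reps_Suc:
  assumes "Suc k \<le> L"
  shows "real (card (class_reps (Suc k))) =
    real q * real (card (class_reps k)) + geom (real q) (Suc k) + (geom (real q) k - (real q ^ k) ^ 3)"
proof -
  have "real (card (params_I (Suc k))) = geom (real q) (Suc k)"
    unfolding card_params_I[OF assms] geom_def by simp
  moreover have "card (params_II (Suc k)) =
      (\<Sum>n<k. q * q ^ n * (q ^ k * (q ^ (k - Suc n) * q ^ (k - Suc n))))"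
    unfolding card_params_II[OF assms] One_nat_def sum.shift_bounds_Suc_ivl
    by (simp add: atLeast0LessThan)
  then have "real (card (params_II (Suc k))) = geom (real q) k - (real q ^ k) ^ 3"
    unfolding geom_tail[symmetric] by simp
  ultimately show ?thesis unfolding card_class_reps_Suc[OF assms] by simp
qed

text \<open>The extra factor \<open>q\<close> clears the negative exponent that the formula would
  have at \<open>k = 0\<close>. With \<open>q ^ k\<close> as an independent variable, the induction
  step is a polynomial identity.\<close>

lemma card_class_reps_closed:
  "k \<le> L \<Longrightarrow> real q * ((real q - 1) * (real q ^ 2 - 1)) * real (card (class_reps k)) =
    (real q ^ 4 + 1) * (real q ^ k) ^ 3 - (real q ^ 3 + real q ^ 2 + real q + 1) * (real q ^ k) ^ 2
    + 2 * real q * real q ^ k"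
proof (induction k)
  case 0
  show ?case by (simp add: power2_eq_square power3_eq_cube power4_eq_xxxx algebra_simps)
next
  case (Suc k)
  define Q a where "Q = real q" and "a = Q ^ k"
  define c A A' where "c = real (card (class_reps k))" and "A = geom Q k" and "A' = geom Q (Suc k)"
  have c: "Q * ((Q - 1) * (Q ^ 2 - 1)) * c = (Q ^ 4 + 1) * a ^ 3 - (Q ^ 3 + Q ^ 2 + Q + 1) * a ^ 2 + 2 * Q * a"
    using Suc unfolding Q_def a_def c_def by simp
  have A: "(Q - 1) * A = Q * a ^ 3 - a ^ 2" "(Q - 1) * A' = Q * (Q * a) ^ 3 - (Q * a) ^ 2"
    unfolding A_def A'_def a_def geom_closed by simp_all
  have "Q * ((Q - 1) * (Q ^ 2 - 1)) * (Q * c + A' + (A - a ^ 3)) =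
      Q * (Q * ((Q - 1) * (Q ^ 2 - 1)) * c)
      + Q * (Q ^ 2 - 1) * ((Q - 1) * A' + (Q - 1) * A - (Q - 1) * a ^ 3)"
    by Groebner_Basis.algebra
  also have "\<dots> = (Q ^ 4 + 1) * (Q * a) ^ 3 - (Q ^ 3 + Q ^ 2 + Q + 1) * (Q * a) ^ 2 + 2 * Q * (Q * a)"
    unfolding c A by Groebner_Basis.algebra
  finally show ?case
    unfolding real_card_class_reps_Suc[OF Suc.prems]
    by (simp add: Q_def a_def c_def A_def A'_def)
qed

lemma card_unit_class_reps_closed:
  assumes "Suc k \<le> L"
  shows "(real q ^ 2 - 1) * real (card {M \<in> class_reps (Suc k). det M \<notin> I 1}) =
    (real q ^ 5 - real q ^ 3 + 2 * real q) * (real q ^ k) ^ 3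
    - (real q ^ 3 + real q + 2) * (real q ^ k) ^ 2 + 2 * real q ^ k"
proof -
  define Q a where "Q = real q" and "a = Q ^ k"
  define c A B where "c = real (card (class_reps k))" and "A = geom Q k"
    and "B = (\<Sum>n<k. Q ^ n * (Q ^ k * (Q ^ (k - Suc n) * Q ^ (k - Suc n))))"
  define r where "r = q - 1"
  have Q: "Q \<noteq> 0" using q_ge_2 unfolding Q_def by auto
  have r: "Q - 1 = real r" using q_ge_2 unfolding Q_def r_def by simp
  have 1: "real (card {a \<in> params_I (Suc k). det (nf_I a) \<notin> I 1}) =
      (Q * a) ^ 2 * ((Q - 1) * a) + (Q - 1) ^ 2 * A"
    unfolding card_units_params_I[OF assms] A_def geom_def a_def r r_def[symmetric]
    by (simp add: Q_def sum_distrib_left power2_eq_square ac_simps)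
  have 2: "real (card {a \<in> params_II (Suc k). det (nf_II a) \<notin> I 1}) = (Q - 1) * B"
    unfolding card_units_params_II[OF assms] B_def r r_def[symmetric]
    by (simp add: Q_def sum_distrib_left ac_simps)
  have B: "Q * B = A - a ^ 3"
    unfolding A_def a_def geom_tail[symmetric] B_def by (simp add: sum_distrib_left algebra_simps)
  have A: "(Q - 1) * A = Q * a ^ 3 - a ^ 2" unfolding A_def a_def geom_closed ..
  have c: "Q * ((Q - 1) * (Q ^ 2 - 1)) * c = (Q ^ 4 + 1) * a ^ 3 - (Q ^ 3 + Q ^ 2 + Q + 1) * a ^ 2 + 2 * Q * a"
    using card_class_reps_closed[of k] assms unfolding Q_def a_def c_def by simp
  \<comment> \<open>The equations for \<open>B\<close> and \<open>c\<close> carry a factor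
    \<open>Q\<close>, so the identity is first proved after multiplication by
    \<open>Q\<close>.\<close>
  have "Q * ((Q ^ 2 - 1) * ((Q - 1) * c + ((Q * a) ^ 2 * ((Q - 1) * a) + (Q - 1) ^ 2 * A) + (Q - 1) * B)) =
      Q * ((Q ^ 5 - Q ^ 3 + 2 * Q) * a ^ 3 - (Q ^ 3 + Q + 2) * a ^ 2 + 2 * a)"
  proof -
    have "Q * ((Q ^ 2 - 1) * ((Q - 1) * c + ((Q * a) ^ 2 * ((Q - 1) * a) + (Q - 1) ^ 2 * A) + (Q - 1) * B)) =
        Q * ((Q - 1) * (Q ^ 2 - 1)) * c + Q * (Q ^ 2 - 1) * (Q * a) ^ 2 * ((Q - 1) * a)
        + Q * (Q ^ 2 - 1) * (Q - 1) * ((Q - 1) * A) + (Q ^ 2 - 1) * ((Q - 1) * (Q * B))"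
      by Groebner_Basis.algebra
    also have "(Q - 1) * (Q * B) = (Q - 1) * A - (Q - 1) * a ^ 3" unfolding B by Groebner_Basis.algebra
    finally show ?thesis unfolding c A by Groebner_Basis.algebra
  qed
  then have "(Q ^ 2 - 1) * ((Q - 1) * c + ((Q * a) ^ 2 * ((Q - 1) * a) + (Q - 1) ^ 2 * A) + (Q - 1) * B) =
      (Q ^ 5 - Q ^ 3 + 2 * Q) * a ^ 3 - (Q ^ 3 + Q + 2) * a ^ 2 + 2 * a"
    using Q(1) by simp
  moreover have "real (card {M \<in> class_reps (Suc k). det M \<notin> I 1}) =
      (Q - 1) * c + ((Q * a) ^ 2 * ((Q - 1) * a) + (Q - 1) ^ 2 * A) + (Q - 1) * B"
    unfolding card_unit_class_reps_Suc[OF assms] of_nat_add 1 2 c_def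
    by (simp add: r r_def)
  ultimately show ?thesis unfolding Q_def a_def by simp
qed

lemma card_class_reps_formula:
  assumes "1 \<le> i" "i \<le> L"
  shows "real (card (class_reps i)) =
    (real q ^ (3*i + 3) + real q ^ (3*i - 1) - real q ^ (2*i + 2) - real q ^ (2*i + 1)
      - real q ^ (2*i) - real q ^ (2*i - 1) + 2 * real q ^ i)
    / ((real q - 1) * (real q ^ 2 - 1))"
proof -
  obtain k where k: "i = Suc k" using assms(1) by (cases i) auto
  define Q a where "Q = real q" and "a = Q ^ k"
  have Q: "Q > 1" using q_ge_2 unfolding Q_def by simp
  then have nz: "(Q - 1) * (Q ^ 2 - 1) \<noteq> 0" by (auto simp: power2_eq_1_iff)
  have a: "Q ^ (3*i + 3) = Q ^ 6 * a ^ 3" "Q ^ (3*i - 1) = Q ^ 2 * a ^ 3" "Q ^ (2*i + 2) = Q ^ 4 * a ^ 2"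
    "Q ^ (2*i + 1) = Q ^ 3 * a ^ 2" "Q ^ (2*i) = Q ^ 2 * a ^ 2" "Q ^ (2*i - 1) = Q * a ^ 2" "Q ^ i = Q * a"
    unfolding k a_def power_mult[symmetric] power_add[symmetric] power_Suc[symmetric]
    by (rule arg_cong[where f = "\<lambda>n. Q ^ n"]; simp)+
  have "Q * ((Q - 1) * (Q ^ 2 - 1) * real (card (class_reps i))) =
      Q * (Q ^ 6 * a ^ 3 + Q ^ 2 * a ^ 3 - Q ^ 4 * a ^ 2 - Q ^ 3 * a ^ 2 - Q ^ 2 * a ^ 2 - Q * a ^ 2 + 2 * (Q * a))"
    using card_class_reps_closed[OF assms(2)] unfolding Q_def[symmetric] a(7) by Groebner_Basis.algebra
  then have "(Q - 1) * (Q ^ 2 - 1) * real (card (class_reps i)) =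
      Q ^ 6 * a ^ 3 + Q ^ 2 * a ^ 3 - Q ^ 4 * a ^ 2 - Q ^ 3 * a ^ 2 - Q ^ 2 * a ^ 2 - Q * a ^ 2 + 2 * (Q * a)"
    using Q by simp
  then show ?thesis
    unfolding Q_def[symmetric] a using nz by (simp add: nonzero_eq_divide_eq mult.commute)
qed

lemma card_unit_class_reps_formula:
  assumes "1 \<le> i" "i \<le> L"
  shows "real (card {M \<in> class_reps i. det M \<notin> I 1}) =
    (real q ^ (3*i + 2) - real q ^ (3*i) + 2 * real q ^ (3*i - 2) - real q ^ (2*i + 1)
      - real q ^ (2*i - 1) - 2 * real q ^ (2*i - 2) + 2 * real q ^ (i - 1))
    / (real q ^ 2 - 1)"
proof -
  obtain k where k: "i = Suc k" using assms(1) by (cases i) auto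
  define Q a where "Q = real q" and "a = Q ^ k"
  have "Q > 1" using q_ge_2 unfolding Q_def by simp
  then have nz: "Q ^ 2 - 1 \<noteq> 0" by (auto simp: power2_eq_1_iff)
  have a: "Q ^ (3*i + 2) = Q ^ 5 * a ^ 3" "Q ^ (3*i) = Q ^ 3 * a ^ 3" "Q ^ (3*i - 2) = Q * a ^ 3"
    "Q ^ (2*i + 1) = Q ^ 3 * a ^ 2" "Q ^ (2*i - 1) = Q * a ^ 2" "Q ^ (2*i - 2) = a ^ 2" "Q ^ (i - 1) = a"
    unfolding k a_def power_mult[symmetric] power_add[symmetric] power_Suc[symmetric]
    by (rule arg_cong[where f = "\<lambda>n. Q ^ n"]; simp)+
  have "(Q ^ 2 - 1) * real (card {M \<in> class_reps i. det M \<notin> I 1}) =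
      Q ^ 5 * a ^ 3 - Q ^ 3 * a ^ 3 + 2 * (Q * a ^ 3) - Q ^ 3 * a ^ 2 - Q * a ^ 2 - 2 * a ^ 2 + 2 * a"
    using card_unit_class_reps_closed[of k] assms(2) unfolding Q_def[symmetric] a_def k
    by (simp add: algebra_simps)
  then show ?thesis
    unfolding Q_def[symmetric] a using nz by (simp add: nonzero_eq_divide_eq mult.commute)
qed

end

section \<open>Transfer to a ring given by a record\<close>

text \<open>The map \<open>h\<close> presents the record \<open>R\<close> as the quotient of
  \<open>'a\<close> by \<open>I k\<close>; applied entrywise, it carries \<open>sim k\<close> to
  similarity over \<open>R\<close>.\<close>

locale truncated_ring_quotient = truncated_principal_local K p L T + R: cring R
  for K :: "'a::comm_ring_1 set" and p L T and R :: "('r, 'e) ring_scheme" (structure) +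
  fixes h :: "'a \<Rightarrow> 'r" and k :: nat
  assumes h_add: "h (x + y) = h x \<oplus> h y"
    and h_mult: "h (x * y) = h x \<otimes> h y"
    and h_one: "h 1 = \<one>"
    and h_range: "range h = carrier R"
    and h_eq_iff: "h x = h y \<longleftrightarrow> x - y \<in> I k"
    and k_bounds: "1 \<le> k" "k \<le> L"
begin

lemma h_closed [simp]: "h x \<in> carrier R"
  using h_range by blast

lemma h_zero: "h 0 = \<zero>"
proof -
  have "h 0 \<oplus> h 0 = h 0" using h_add[of 0 0] by simp
  then show ?thesis by (metis R.add.r_cancel_one' h_closed)
qed

lemma h_sum: "finite F \<Longrightarrow> h (sum f F) = (\<Oplus>x\<in>F. h (f x))"
  by (induction F rule: finite_induct) (simp_all add: h_zero h_add)

definition H :: "'a ^ 3 ^ 3 \<Rightarrow> 'r ^ 3 ^ 3" where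
  "H M = (\<chi> i j. h (M $ i $ j))"

lemma H_closed [simp]: "H M \<in> carrier (mat_monoid R)"
  by (simp add: H_def mat_monoid_def)

lemma H_surj: "N \<in> carrier (mat_monoid R) \<Longrightarrow> \<exists>M. N = H M"
proof -
  assume "N \<in> carrier (mat_monoid R)"
  then have "\<exists>x. N $ i $ j = h x" for i j
    using h_range by (auto simp: mat_monoid_def)
  then obtain f where "\<And>i j. N $ i $ j = h (f i j)" by metis
  then have "N = H (\<chi> i j. f i j)" by (simp add: H_def vec_eq_iff)
  then show ?thesis ..
qed

lemma H_mult: "H M \<otimes>\<^bsub>mat_monoid R\<^esub> H N = H (M ** N)"
  by (simp add: H_def mat_monoid_def matrix_matrix_mult_def h_sum h_mult vec_eq_iff)

lemma H_one: "\<one>\<^bsub>mat_monoid R\<^esub> = H (mat 1)"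
  by (simp add: H_def mat_monoid_def mat_def vec_eq_iff h_one h_zero)

lemma H_eq_iff: "H M = H N \<longleftrightarrow> mcong k M N"
  by (simp add: H_def mcong_def vec_eq_iff h_eq_iff)

text \<open>An inverse modulo \<open>I k\<close> makes \<open>det X\<close> invertible modulo
  \<open>I 1\<close>. Conversely, an inverse \<open>d\<close> of the determinant gives the inverse
  \<open>mat d ** adj3 X\<close>.\<close>

lemma H_in_Units_iff: "H X \<in> Units (mat_monoid R) \<longleftrightarrow> det X \<notin> I 1"
proof
  assume "H X \<in> Units (mat_monoid R)"
  then obtain Y where "H X \<otimes>\<^bsub>mat_monoid R\<^esub> H Y = \<one>\<^bsub>mat_monoid R\<^esub>"
    unfolding Units_def using H_surj by blast
  then have "mcong k (X ** Y) (mat 1)" by (simp add: H_mult H_one H_eq_iff)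
  then have "det X * det Y - 1 \<in> I 1"
    using I_antimono[OF mcong_det k_bounds(1)] by (fastforce simp: det_mul)
  then show "det X \<notin> I 1" using I_shift I_mult_right one_not_in by (metis One_nat_def)
next
  assume "det X \<notin> I 1"
  then obtain d where d: "det X * d - 1 \<in> I k" using I_unit by blast
  define Y where "Y = mat d ** adj3 X"
  have "X ** Y = mat d ** mat (det X)" "Y ** X = mat d ** mat (det X)"
    unfolding Y_def matrix_mult_mat_left mult_adj3 adj3_mult by simp_all
  moreover have "mcong k (mat d ** mat (det X)) (mat 1)"
    using d by (simp add: mcong_def forall_3 mult.commute)
  ultimately have "H X \<otimes>\<^bsub>mat_monoid R\<^esub> H Y = \<one>\<^bsub>mat_monoid R\<^esub>"
    "H Y \<otimes>\<^bsub>mat_monoid R\<^esub> H X = \<one>\<^bsub>mat_monoid R\<^esub>"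
    by (simp_all add: H_mult H_one H_eq_iff)
  then show "H X \<in> Units (mat_monoid R)" unfolding Units_def using H_closed by blast
qed

lemma H_similar_iff: "(H M, H N) \<in> similarity R \<longleftrightarrow> sim k M N"
proof -
  have "(H M, H N) \<in> similarity R \<longleftrightarrow>
      (\<exists>X\<in>Units (mat_monoid R). X \<otimes>\<^bsub>mat_monoid R\<^esub> H M = H N \<otimes>\<^bsub>mat_monoid R\<^esub> X)"
    by (simp add: similarity_def)
  also have "\<dots> \<longleftrightarrow> (\<exists>X. H X \<in> Units (mat_monoid R) \<and>
      H X \<otimes>\<^bsub>mat_monoid R\<^esub> H M = H N \<otimes>\<^bsub>mat_monoid R\<^esub> H X)"
    using H_surj unfolding Units_def by blast
  finally show ?thesis by (simp add: H_in_Units_iff H_mult H_eq_iff sim_def)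
qed

lemma similarity_class: "similarity R `` {H M} = H ` {N. sim k M N}"
proof -
  have "Y \<in> range H" if "(H M, Y) \<in> similarity R" for Y
    using that H_surj unfolding similarity_def by blast
  then show ?thesis using H_similar_iff by blast
qed

lemma similarity_class_eq_iff: "similarity R `` {H M} = similarity R `` {H N} \<longleftrightarrow> sim k M N"
proof
  assume "similarity R `` {H M} = similarity R `` {H N}"
  moreover have "H N \<in> similarity R `` {H N}" by (simp add: H_similar_iff)
  ultimately have "(H M, H N) \<in> similarity R" by blast
  then show "sim k M N" by (simp add: H_similar_iff)
next
  assume "sim k M N"
  then have "{L. sim k M L} = {L. sim k N L}" using sim_sym sim_trans by blast
  then show "similarity R `` {H M} = similarity R `` {H N}" by (simp add: similarity_class)
qed

text \<open>As \<open>P\<close> is a class invariant, every class in \<open>D\<close> meets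
  \<open>class_reps k\<close> in exactly one matrix, and that matrix satisfies
  \<open>P\<close>.\<close>

lemma card_quotient_similarity:
  assumes D: "D = {H M | M. P M}" and P: "\<And>M N. sim k M N \<Longrightarrow> P M \<longleftrightarrow> P N"
  shows "card (D // similarity R) = card {M \<in> class_reps k. P M}"
proof -
  let ?f = "\<lambda>M. similarity R `` {H M}"
  have "D // similarity R = ?f ` {M \<in> class_reps k. P M}"
  proof (intro Set.equalityI Set.subsetI)
    fix C assume "C \<in> D // similarity R"
    then obtain M where M: "P M" "C = ?f M" unfolding quotient_def D by blast
    obtain A where "A \<in> class_reps k" "sim k A M" using class_reps_ex k_bounds by blast
    then show "C \<in> ?f ` {M \<in> class_reps k. P M}"
      using M P similarity_class_eq_iff by blast
  next
    fix C assume "C \<in> ?f ` {M \<in> class_reps k. P M}"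
    then show "C \<in> D // similarity R" unfolding quotient_def D by blast
  qed
  moreover have "inj_on ?f {M \<in> class_reps k. P M}"
    using similarity_class_eq_iff class_reps_unique k_bounds by (intro inj_onI) blast
  ultimately show ?thesis by (simp add: card_image)
qed

lemma card_similarity_classes:
  "card (similarity_classes R :: ('r ^ 3 ^ 3) set set) = card (class_reps k)"
  unfolding similarity_classes_def
proof -
  have "carrier (mat_monoid R) = {H M | M. True}" using H_surj H_closed by blast
  from card_quotient_similarity[OF this]
  show "card (carrier (mat_monoid R) // similarity R :: ('r ^ 3 ^ 3) set set) = card (class_reps k)"
    by simp
qed

lemma card_GL_similarity_classes:
  "card (GL_similarity_classes R :: ('r ^ 3 ^ 3) set set) = card {M \<in> class_reps k. det M \<notin> I 1}"
  unfolding GL_similarity_classes_def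
proof (rule card_quotient_similarity)
  show "Units (mat_monoid R) = {H M |M. det M \<notin> I 1}"
    using H_surj H_in_Units_iff unfolding Units_def by blast
  show "det M \<notin> I 1 \<longleftrightarrow> det N \<notin> I 1" if "sim k M N" for M N
    using I_shift[OF I_antimono[OF sim_det[OF that] k_bounds(1)]] by blast
qed

end

section \<open>Commutative rings as quotients of a type-class ring\<close>

text \<open>The product of all commutative ring structures with elements in \<open>'a\<close>, a type that projects
  onto each of them. The additional factor of integers ensures \<open>0 \<noteq> 1\<close> when all of these rings
  are trivial.\<close>

typedef ('a, 'b) cring_prod =
  "{(n :: int, f :: ('a, 'b) ring_scheme \<Rightarrow> 'a). \<forall>R. if cring R then f R \<in> carrier R else f R = undefined}"
proof
  show "(0, \<lambda>R. if cring R then \<zero>\<^bsub>R\<^esub> else undefined) \<in>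
      {(n :: int, f :: ('a, 'b) ring_scheme \<Rightarrow> 'a).
        \<forall>R. if cring R then f R \<in> carrier R else f R = undefined}"
    by (simp add: cring.cring_simprules)
qed

setup_lifting type_definition_cring_prod

instantiation cring_prod :: (type, type) comm_ring_1
begin

lift_definition zero_cring_prod :: "('a, 'b) cring_prod"
  is "(0, \<lambda>R. if cring R then \<zero>\<^bsub>R\<^esub> else undefined)"
  by (simp add: cring.cring_simprules)

lift_definition one_cring_prod :: "('a, 'b) cring_prod"
  is "(1, \<lambda>R. if cring R then \<one>\<^bsub>R\<^esub> else undefined)"
  by (simp add: cring.cring_simprules)

lift_definition plus_cring_prod :: "('a, 'b) cring_prod \<Rightarrow> ('a, 'b) cring_prod \<Rightarrow> ('a, 'b) cring_prod"
  is "\<lambda>(m, f) (n, g). (m + n, \<lambda>R. if cring R then f R \<oplus>\<^bsub>R\<^esub> g R else undefined)"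
  by (auto simp: cring.cring_simprules)

lift_definition times_cring_prod :: "('a, 'b) cring_prod \<Rightarrow> ('a, 'b) cring_prod \<Rightarrow> ('a, 'b) cring_prod"
  is "\<lambda>(m, f) (n, g). (m * n, \<lambda>R. if cring R then f R \<otimes>\<^bsub>R\<^esub> g R else undefined)"
  by (auto simp: cring.cring_simprules)

lift_definition uminus_cring_prod :: "('a, 'b) cring_prod \<Rightarrow> ('a, 'b) cring_prod"
  is "\<lambda>(m, f). (- m, \<lambda>R. if cring R then \<ominus>\<^bsub>R\<^esub> f R else undefined)"
  by (auto simp: cring.cring_simprules)

definition minus_cring_prod :: "('a, 'b) cring_prod \<Rightarrow> ('a, 'b) cring_prod \<Rightarrow> ('a, 'b) cring_prod"
  where "minus_cring_prod x y = x + - y"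

instance
proof
  fix a b c :: "('a, 'b) cring_prod"
  show "a + b + c = a + (b + c)"
    by transfer (auto simp: fun_eq_iff cring.cring_simprules)
  show "a + b = b + a"
    by transfer (auto simp: fun_eq_iff cring.cring_simprules)
  show "0 + a = a"
    by transfer (auto simp: fun_eq_iff cring.cring_simprules)
  show "- a + a = 0"
    by transfer (auto simp: fun_eq_iff cring.cring_simprules)
  show "a - b = a + - b"
    by (simp add: minus_cring_prod_def)
  show "a * b * c = a * (b * c)"
    by transfer (auto simp: fun_eq_iff cring.cring_simprules)
  show "a * b = b * a"
    by transfer (auto simp: fun_eq_iff cring.cring_simprules)
  show "1 * a = a"
    by transfer (auto simp: fun_eq_iff cring.cring_simprules(12))
  show "(a + b) * c = a * c + b * c"
    by transfer (auto simp: fun_eq_iff cring.cring_simprules algebra_simps)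
  show "(0 :: ('a, 'b) cring_prod) \<noteq> 1"
    by transfer simp
qed

end

lift_definition component :: "('a, 'b) ring_scheme \<Rightarrow> ('a, 'b) cring_prod \<Rightarrow> 'a"
  is "\<lambda>R (n, f). f R" .

lemma component_closed: "cring R \<Longrightarrow> component R x \<in> carrier R"
  by transfer auto

lemma component_zero: "cring R \<Longrightarrow> component R 0 = \<zero>\<^bsub>R\<^esub>"
  by transfer simp

lemma component_one: "cring R \<Longrightarrow> component R 1 = \<one>\<^bsub>R\<^esub>"
  by transfer simp

lemma component_add: "cring R \<Longrightarrow> component R (x + y) = component R x \<oplus>\<^bsub>R\<^esub> component R y"
  by transfer auto

lemma component_mult: "cring R \<Longrightarrow> component R (x * y) = component R x \<otimes>\<^bsub>R\<^esub> component R y"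
  by transfer auto

lemma component_uminus: "cring R \<Longrightarrow> component R (- x) = \<ominus>\<^bsub>R\<^esub> component R x"
  by transfer auto

lemma component_surj:
  fixes R :: "('a, 'b) ring_scheme"
  assumes "cring R" "a \<in> carrier R"
  shows "\<exists>x. component R x = a"
proof -
  define f where "f R' = (if cring R' then if R' = R then a else \<zero>\<^bsub>R'\<^esub> else undefined)"
    for R' :: "('a, 'b) ring_scheme"
  have "component R (Abs_cring_prod (0, f)) = a"
    using assms by (simp add: component.rep_eq Abs_cring_prod_inverse f_def cring.cring_simprules)
  then show ?thesis ..
qed

section \<open>Projections, principal ideals and units in rings given by records\<close>

context cring
begin

lemmas component_hom =
  component_closed component_zero component_one component_add component_mult component_uminus
lemmas [simp] = component_hom[OF is_cring]

lemma component_diff: "component R (x - y) = component R x \<ominus> component R y"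
  unfolding minus_cring_prod_def minus_eq by (simp only: component_hom[OF is_cring])

lemma component_power: "component R (x ^ n) = component R x [^] n"
  by (induction n) (simp_all add: m_comm)

lemma range_component: "range (component R) = carrier R"
  using component_closed[OF is_cring] component_surj[OF is_cring] by blast

text \<open>Zorn's lemma is applied to the ideals that contain \<open>J\<close> and avoid
  \<open>\<one>\<close>, a family closed under unions of nonempty chains.\<close>

lemma exists_maximalideal:
  assumes "ideal J R" "\<one> \<notin> J"
  shows "\<exists>M. maximalideal M R \<and> J \<subseteq> M"
proof -
  define P where "P = {I. ideal I R \<and> J \<subseteq> I \<and> \<one> \<notin> I}"
  have "\<exists>M\<in>P. \<forall>X\<in>P. M \<subseteq> X \<longrightarrow> X = M"
  proof (rule subset_Zorn_nonempty)
    show "P \<noteq> {}" using assms by (auto simp: P_def)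
    fix C assume C: "C \<noteq> {}" "subset.chain P C"
    then have "subset.chain {I. ideal I R} C" unfolding pred_on.chain_def P_def by blast
    from chain_Union_is_ideal[OF this] have "ideal (\<Union>C) R" using C(1) by simp
    then show "\<Union>C \<in> P" using C unfolding pred_on.chain_def P_def by blast
  qed
  then obtain M where M: "M \<in> P" and max: "\<And>X. X \<in> P \<Longrightarrow> M \<subseteq> X \<Longrightarrow> X = M" by blast
  have "maximalideal M R"
  proof (rule maximalidealI)
    show "ideal M R" using M by (simp add: P_def)
    show "carrier R \<noteq> M" using M by (auto simp: P_def)
    fix X assume X: "ideal X R" "M \<subseteq> X" "X \<subseteq> carrier R"
    show "X = M \<or> X = carrier R"
    proof (cases "\<one> \<in> X")
      case True then show ?thesis using ideal.one_imp_carrier X(1) by blast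
    next
      case False
      then have "X \<in> P" using X M by (auto simp: P_def)
      then show ?thesis using max X(2) by blast
    qed
  qed
  then show ?thesis using M by (auto simp: P_def)
qed

text \<open>The induction rests on the product of two principal ideals being generated by the
  product of the generators. This links powers of the maximal ideal with the powers of
  \<open>p\<close> that define \<open>I\<close>.\<close>

lemma ideal_power_cgenideal:
  assumes "a \<in> carrier R" shows "ideal_power R (PIdl a) n = PIdl (a [^] n)"
proof (induction n)
  case 0
  have "PIdl \<one> = carrier R" unfolding cgenideal_def by force
  then show ?case by (simp add: ideals_set_def)
next
  case (Suc n)
  have "(PIdl x) \<cdot> (PIdl y) = PIdl (x \<otimes> y)" if "x \<in> carrier R" "y \<in> carrier R" for x y
  proof
    show "(PIdl x) \<cdot> (PIdl y) \<subseteq> PIdl (x \<otimes> y)"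
    proof
      fix s assume "s \<in> (PIdl x) \<cdot> (PIdl y)"
      then show "s \<in> PIdl (x \<otimes> y)"
      proof (induction rule: ideal_prod.induct)
        case (prod i j)
        then obtain b c where bc: "b \<in> carrier R" "c \<in> carrier R" "i = b \<otimes> x" "j = c \<otimes> y"
          unfolding cgenideal_def by blast
        then have "i \<otimes> j = (b \<otimes> c) \<otimes> (x \<otimes> y)" using that by (simp add: m_ac)
        then show ?case using bc unfolding cgenideal_def by blast
      next
        case (sum s1 s2)
        then show ?case
          using additive_subgroup.a_closed[OF ideal.axioms(1)[OF cgenideal_ideal]] that by blast
      qed
    qed
    have "x \<otimes> y \<in> (PIdl x) \<cdot> (PIdl y)" using cgenideal_self that by (intro ideal_prod.prod)
    then show "PIdl (x \<otimes> y) \<subseteq> (PIdl x) \<cdot> (PIdl y)"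
      using that by (intro cgenideal_minimal ideal_prod_is_ideal cgenideal_ideal)
  qed
  from this[of "a [^] n" a] Suc assms show ?case by (simp add: ideals_set_def)
qed

end

text \<open>A non-unit generates a proper ideal, which lies in some maximal ideal and hence in the
  only one.\<close>

lemma (in local_ring) nonunit_in_maximalideal:
  assumes "maximalideal m R" "x \<in> carrier R" "x \<notin> m"
  shows "\<exists>y\<in>carrier R. x \<otimes> y = \<one>"
proof (rule ccontr)
  assume no_inverse: "\<not> ?thesis"
  have "\<one> \<notin> PIdl x"
    unfolding cgenideal_def using no_inverse assms(2) by (auto simp: m_comm)
  then obtain M where "maximalideal M R" "PIdl x \<subseteq> M"
    using exists_maximalideal cgenideal_ideal assms(2) by blast
  then show False using ex1_maximalideal assms cgenideal_self by blast
qed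

lemma (in cring) component_coset_eq_iff:
  assumes "ideal J R"
  shows "J +> component R x = J +> component R y \<longleftrightarrow> component R (x - y) \<in> J"
  unfolding component_diff using quotient_eq_iff_same_a_r_cos[OF assms] by simp

lemma (in cring) carrier_Quot_component:
  "carrier (R Quot J) = range (\<lambda>x. J +> component R x)"
  by (auto simp: FactRing_def A_RCOSETS_def' range_component[symmetric])

section \<open>The numbers of similarity classes\<close>

theorem theorem5p2:
  fixes A :: "('a, 'b) ring_scheme" and m :: "'a set" and l :: enat and q i :: nat
  assumes "local_ring A"
    and "principal_ideal_ring A"
    and "maximalideal m A"
    and "l = nilpotency_length A m"
    and "finite (carrier (A Quot m))"
    and "q = card (carrier (A Quot m))"
    and "1 \<le> i" and "enat i \<le> l"
  shows "real (card (similarity_classes (A Quot ideal_power A m i) :: ('a set ^ 3 ^ 3) set set)) =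
           (real q ^ (3*i + 3) + real q ^ (3*i - 1) - real q ^ (2*i + 2) - real q ^ (2*i + 1)
             - real q ^ (2*i) - real q ^ (2*i - 1) + 2 * real q ^ i)
           / ((real q - 1) * (real q ^ 2 - 1))
    \<and> real (card (GL_similarity_classes (A Quot ideal_power A m i) :: ('a set ^ 3 ^ 3) set set)) =
           (real q ^ (3*i + 2) - real q ^ (3*i) + 2 * real q ^ (3*i - 2) - real q ^ (2*i + 1)
             - real q ^ (2*i - 1) - 2 * real q ^ (2*i - 2) + 2 * real q ^ (i - 1))
           / (real q ^ 2 - 1)"
proof -
  interpret A: local_ring A by fact
  interpret A': principal_ideal_ring A by fact
  interpret m: maximalideal m A by fact
  have one_notin_m: "\<one>\<^bsub>A\<^esub> \<notin> m" using m.one_imp_carrier m.I_notcarr by blast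
  obtain a where a: "a \<in> carrier A" "m = PIdl\<^bsub>A\<^esub> a"
    using principalideal.generate[OF A'.all_principalideal[OF m.is_ideal]] A.cgenideal_eq_genideal
    by metis
  obtain p where p: "component A p = a" using component_surj[OF A.is_cring a(1)] by blast
  define K where "K = {x. component A x = \<zero>\<^bsub>A\<^esub>}"
  define J where "J j = ideal_power A m j" for j
  have J_eq: "J j = PIdl\<^bsub>A\<^esub> (a [^]\<^bsub>A\<^esub> j)" for j
    unfolding J_def a(2) by (rule A.ideal_power_cgenideal[OF a(1)])
  have J_ideal: "ideal (J j) A" for j
    unfolding J_eq using a(1) by (intro A.cgenideal_ideal) simp
  have J_1: "J 1 = m" unfolding J_eq a(2) using a(1) by simp
  have in_J: "component A x \<in> J j \<longleftrightarrow> (\<exists>y. x - p ^ j * y \<in> K)" for x j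
  proof -
    have "x - p ^ j * y \<in> K \<longleftrightarrow> component A x = component A y \<otimes>\<^bsub>A\<^esub> a [^]\<^bsub>A\<^esub> j" for y
      using a(1) by (simp add: K_def A.component_diff A.component_power p A.m_comm[of "a [^]\<^bsub>A\<^esub> j"])
    moreover have "component A x \<in> J j \<longleftrightarrow> (\<exists>c\<in>range (component A). component A x = c \<otimes>\<^bsub>A\<^esub> a [^]\<^bsub>A\<^esub> j)"
      unfolding J_eq cgenideal_def A.range_component by blast
    ultimately show ?thesis by simp
  qed
  have in_m: "component A x \<in> m \<longleftrightarrow> (\<exists>y. x - p * y \<in> K)" for x
    using in_J[of x 1] J_1 by simp
  have inverse: "\<exists>y. x * y - 1 \<in> K" if x: "component A x \<notin> m" for x
  proof -
    obtain b where b: "b \<in> carrier A" "component A x \<otimes>\<^bsub>A\<^esub> b = \<one>\<^bsub>A\<^esub>"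
      using A.nonunit_in_maximalideal[OF assms(3) _ x] by auto
    then obtain y where "component A y = b" using component_surj[OF A.is_cring] by blast
    then have "x * y - 1 \<in> K" using b by (simp add: K_def A.component_diff)
    then show ?thesis ..
  qed
  \<comment> \<open>The digits are chosen in the type-class ring: one preimage for each residue
    class.\<close>
  define rep where "rep C = (SOME x. m +>\<^bsub>A\<^esub> component A x = C)" for C
  define T where "T = rep ` carrier (A Quot m)"
  have rep: "m +>\<^bsub>A\<^esub> component A (rep C) = C" if "C \<in> carrier (A Quot m)" for C
    unfolding rep_def by (rule someI_ex) (use that in \<open>auto simp: A.carrier_Quot_component\<close>)
  then have "inj_on rep (carrier (A Quot m))" by (metis inj_onI)
  then have card_T: "card T = q" unfolding T_def assms(6) by (rule card_image)
  have K_ideal: "x + y \<in> K" "c * x \<in> K" if "x \<in> K" "y \<in> K" for x y c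
    using that by (simp_all add: K_def)
  \<comment> \<open>Taking \<open>L = i\<close> treats finite and infinite length alike.\<close>
  interpret truncated_principal_local K p i T
  proof
    show "0 \<in> K" by (simp add: K_def)
    show "x + y \<in> K" if "x \<in> K" "y \<in> K" for x y using that by (rule K_ideal)
    show "c * x \<in> K" if "x \<in> K" for x c using that that by (rule K_ideal)
    show "\<exists>y. x * y - 1 \<in> K" if "\<And>y. x - p * y \<notin> K" for x
      using inverse in_m that by blast
    show "p ^ j - p ^ Suc j * y \<notin> K" if "j < i" for j y
    proof
      \<comment> \<open>As \<open>1 - p * y\<close> is a unit, the assumption makes \<open>a\<close>
        to the power \<open>j\<close> zero, so the length would be at most \<open>j < i\<close>. The
        exponent \<open>j = 0\<close>, outside the range of the length, would instead give
        \<open>\<one> = \<zero>\<close>.\<close>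
      assume "p ^ j - p ^ Suc j * y \<in> K"
      then have K: "p ^ j * (1 - p * y) \<in> K" by (simp add: algebra_simps)
      have "component A (1 - p * y) \<notin> m"
      proof
        assume "component A (1 - p * y) \<in> m"
        moreover have "component A (p * y) \<in> m" unfolding in_m by (rule exI[of _ y]) (simp add: K_def)
        ultimately have "component A (1 - p * y) \<oplus>\<^bsub>A\<^esub> component A (p * y) \<in> m" by (rule m.a_closed)
        then have "component A (1 - p * y + p * y) \<in> m" by (simp only: component_add[OF A.is_cring])
        then show False using one_notin_m by simp
      qed
      then obtain c where c: "(1 - p * y) * c - 1 \<in> K" using inverse by blast
      have "c * (p ^ j * (1 - p * y)) + - (p ^ j) * ((1 - p * y) * c - 1) \<in> K"
        using K c K_ideal by blast
      then have "p ^ j \<in> K" by (simp add: algebra_simps)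
      then have a0: "a [^]\<^bsub>A\<^esub> j = \<zero>\<^bsub>A\<^esub>" by (simp add: K_def A.component_power p)
      show False
      proof (cases "j = 0")
        case True
        then show False using a0 one_notin_m m.zero_closed by simp
      next
        case False
        have "J j = {\<zero>\<^bsub>A\<^esub>}" unfolding J_eq a0 cgenideal_def by force
        then have j: "1 \<le> j \<and> ideal_power A m j = {\<zero>\<^bsub>A\<^esub>}" using False by (simp add: J_def)
        then have "nilpotency_length A m = enat (LEAST n. 1 \<le> n \<and> ideal_power A m n = {\<zero>\<^bsub>A\<^esub>})"
          unfolding nilpotency_length_def by auto
        also have "\<dots> \<le> enat j" using j by (simp add: Least_le)
        finally show False using assms(4,8) \<open>j < i\<close> by (metis enat_ord_simps(1) leD order_trans)
      qed
    qed
    show "0 < i" using assms(7) by simp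
    show "finite T" unfolding T_def using assms(5) by simp
    show "\<exists>s\<in>T. \<exists>y. x - s - p * y \<in> K" for x
    proof -
      have "m +>\<^bsub>A\<^esub> component A x \<in> carrier (A Quot m)" by (simp add: A.carrier_Quot_component)
      then have "rep (m +>\<^bsub>A\<^esub> component A x) \<in> T"
        "component A (x - rep (m +>\<^bsub>A\<^esub> component A x)) \<in> m"
        using rep A.component_coset_eq_iff[OF m.is_ideal] unfolding T_def by blast+
      then show ?thesis using in_m by blast
    qed
    show "s = t" if "s \<in> T" "t \<in> T" "s - t - p * y \<in> K" for s t y
    proof -
      have "m +>\<^bsub>A\<^esub> component A s = m +>\<^bsub>A\<^esub> component A t"
        using that(3) in_m A.component_coset_eq_iff[OF m.is_ideal] by blast
      then show ?thesis using that(1,2) rep unfolding T_def by auto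
    qed
  qed
  interpret J: ideal "J i" A by (rule J_ideal)
  have hom: "(+>\<^bsub>A\<^esub>) (J i) \<in> ring_hom A (A Quot J i)" by (rule J.rcos_ring_hom)
  interpret truncated_ring_quotient K p i T "A Quot J i" "\<lambda>x. J i +>\<^bsub>A\<^esub> component A x" i
  proof (intro truncated_ring_quotient.intro truncated_ring_quotient_axioms.intro)
    show "truncated_principal_local K p i T" ..
    show "cring (A Quot J i)" by (rule J.quotient_is_cring[OF A.is_cring])
    show "range (\<lambda>x. J i +>\<^bsub>A\<^esub> component A x) = carrier (A Quot J i)"
      by (simp add: A.carrier_Quot_component)
    show "J i +>\<^bsub>A\<^esub> component A x = J i +>\<^bsub>A\<^esub> component A y \<longleftrightarrow> x - y \<in> I i" for x y
      unfolding A.component_coset_eq_iff[OF J_ideal] I_def in_J by simp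
  qed (use assms(7) ring_hom_add[OF hom] ring_hom_mult[OF hom] ring_hom_one[OF hom] in simp_all)
  show ?thesis
    using card_similarity_classes card_GL_similarity_classes card_class_reps_formula[OF assms(7) order_refl]
      card_unit_class_reps_formula[OF assms(7) order_refl] unfolding card_T J_def by simp
qed

end
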